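(* For all norms $\|\cdot\|$ on $\mathbb{R}^2$ besides a meagre set, the unit distance graph of $\|\cdot\|$ has chromatic number equal to $4$.
   Context: The unit distance graph of a norm $\|\cdot\|$ on $\mathbb{R}^2$ is the graph whose vertices are all points of $\mathbb{R}^2$, where two points are adjacent if and only if the distance between them according to $\|\cdot\|$ is exactly $1$. Let $\mathcal{B}_2$ be the set of all closed, bounded, $\mathbf{0}$-symmetric convex bodies in $\mathbb{R}^2$ containing $\mathbf{0}$ in the interior. The map sending a norm $\|\cdot\|$ to its unit ball $\{\mathbf{x}\in\mathbb{R}^2: \|\mathbf{x}\|\le 1\}$ is a bijection between norms on $\mathbb{R}^2$ and $\mathcal{B}_2$. The set $\mathcal{B}_2$ is endowed with the Hausdorff metric $d_H(A,B)=\max\{\sup_{\mathbf{a}\in A}\inf_{\mathbf{b}\in B}\|\mathbf{a}-\mathbf{b}\|_2,\ \sup_{\mathbf{b}\in B}\inf_{\mathbf{a}\in A}\|\mathbf{a}-\mathbf{b}\|_2\}$, where $\|\cdot\|_2$ is the Euclidean norm. A set in a metric space is nowhere dense if every non-empty open set contains a non-empty open subset disjoint from it; a meagre set is a countable union of nowhere dense sets. A property holds for all norms besides a meagre set if the set of unit balls of the norms failing the property is a meagre set in $(\mathcal{B}_2,d_H)$. *)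

theory Defs
  imports "HOL-Analysis.Analysis"
begin

section \<open>Norms on the plane and their unit balls\<close>

text \<open>
  The overloaded \<open>norm\<close> and \<open>dist\<close> on \<open>real ^ 2\<close> are always the Euclidean ones; an arbitrary
  norm on the plane is a function satisfying the following predicate.
\<close>

definition is_norm :: "('a::real_vector \<Rightarrow> real) \<Rightarrow> bool" where
  "is_norm N \<longleftrightarrow>
     (\<forall>x. 0 \<le> N x) \<and>
     (\<forall>x. N x = 0 \<longleftrightarrow> x = 0) \<and>
     (\<forall>r x. N (r *\<^sub>R x) = \<bar>r\<bar> * N x) \<and>
     (\<forall>x y. N (x + y) \<le> N x + N y)"

definition unit_ball :: "('a::real_vector \<Rightarrow> real) \<Rightarrow> 'a set" where
  "unit_ball N = {x. N x \<le> 1}"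

definition bodies2 :: "(real ^ 2) set set" where
  "bodies2 = {K. closed K \<and> bounded K \<and> convex K \<and> (\<forall>x\<in>K. - x \<in> K) \<and> 0 \<in> interior K}"

section \<open>The Hausdorff metric\<close>

text \<open>
  \<open>infdist a B\<close> is the infimum of \<open>dist a b\<close> over \<open>b \<in> B\<close>, for nonempty \<open>B\<close>. The default value
  \<open>0\<close> is never used for elements of \<open>bodies2\<close>; it is there because the locale \<open>Metric_space\<close>
  requires the distance to be nonnegative also outside the carrier.
\<close>

definition hausdorff_dist :: "'a::metric_space set \<Rightarrow> 'a set \<Rightarrow> real" where
  "hausdorff_dist A B =
     (if A \<noteq> {} \<and> B \<noteq> {} \<and> bounded A \<and> bounded B
      then max (SUP a\<in>A. infdist a B) (SUP b\<in>B. infdist b A)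
      else 0)"

lemma hausdorff_dist_commute: "hausdorff_dist A B = hausdorff_dist B A"
  by (simp add: hausdorff_dist_def max.commute conj_ac)

lemma bdd_above_infdist:
  fixes A B :: "'a::metric_space set"
  assumes "bounded A"
  shows "bdd_above ((\<lambda>a. infdist a B) ` A)"
proof -
  obtain x r where r: "\<forall>a\<in>A. dist x a \<le> r"
    using assms by (auto simp: bounded_def)
  show ?thesis
  proof (rule bdd_aboveI2)
    fix a assume "a \<in> A"
    then show "infdist a B \<le> infdist x B + r"
      using r infdist_triangle[of a B x] by (force simp: dist_commute)
  qed
qed

lemma infdist_le_hausdorff_dist:
  assumes "bounded A" "bounded B" "B \<noteq> {}" "a \<in> A"
  shows "infdist a B \<le> hausdorff_dist A B"
  using cSUP_upper[OF assms(4) bdd_above_infdist[OF assms(1), of B]] assms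
  by (auto simp: hausdorff_dist_def intro: max.coboundedI1)

lemma hausdorff_dist_nonneg: "0 \<le> hausdorff_dist A B"
proof (cases "A \<noteq> {} \<and> B \<noteq> {} \<and> bounded A \<and> bounded B")
  case True
  then obtain a where "a \<in> A" by blast
  then show ?thesis
    using True infdist_le_hausdorff_dist[of A B a] infdist_nonneg[of a B] by linarith
next
  case False
  then have "hausdorff_dist A B = 0"
    unfolding hausdorff_dist_def by (rule if_not_P)
  then show ?thesis by simp
qed

lemma hausdorff_dist_le:
  assumes "A \<noteq> {}" "B \<noteq> {}" "bounded A" "bounded B"
    and "\<And>a. a \<in> A \<Longrightarrow> infdist a B \<le> r" "\<And>b. b \<in> B \<Longrightarrow> infdist b A \<le> r"
  shows "hausdorff_dist A B \<le> r"
  unfolding hausdorff_dist_def using assms by (auto intro!: cSUP_least)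

lemma bodies2D: "K \<in> bodies2 \<Longrightarrow> K \<noteq> {} \<and> closed K \<and> bounded K"
  unfolding bodies2_def using interior_subset by blast

lemma infdist_triangle_hausdorff:
  assumes "A \<in> bodies2" "B \<in> bodies2" "C \<in> bodies2" "a \<in> A"
  shows "infdist a C \<le> hausdorff_dist A B + hausdorff_dist B C"
proof -
  obtain b where b: "b \<in> B" "infdist a B = dist a b"
    using assms(2) bodies2D infdist_attains_inf[of B a] by metis
  have "infdist a B \<le> hausdorff_dist A B" "infdist b C \<le> hausdorff_dist B C"
    using assms(4) b(1) bodies2D[OF assms(1)] bodies2D[OF assms(2)] bodies2D[OF assms(3)]
    by (blast intro: infdist_le_hausdorff_dist)+
  then show ?thesis
    using infdist_triangle[of a C b] b by simp
qed

lemma hausdorff_dist_zero_subset: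
  assumes "A \<in> bodies2" "B \<in> bodies2" "hausdorff_dist A B = 0"
  shows "A \<subseteq> B"
proof
  fix a assume "a \<in> A"
  then have "infdist a B \<le> 0"
    using infdist_le_hausdorff_dist[of A B a] assms bodies2D by metis
  then have "infdist a B = 0"
    using infdist_nonneg[of a B] by linarith
  then show "a \<in> B"
    using assms bodies2D in_closed_iff_infdist_zero by metis
qed

interpretation Hausdorff: Metric_space bodies2 hausdorff_dist
proof
  fix A B :: "(real ^ 2) set"
  show "0 \<le> hausdorff_dist A B"
    by (rule hausdorff_dist_nonneg)
  show "hausdorff_dist A B = hausdorff_dist B A"
    by (rule hausdorff_dist_commute)
next
  fix A B assume A: "A \<in> bodies2" and B: "B \<in> bodies2"
  show "hausdorff_dist A B = 0 \<longleftrightarrow> A = B"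
  proof
    assume "hausdorff_dist A B = 0"
    then show "A = B"
      using hausdorff_dist_zero_subset A B hausdorff_dist_commute by (metis subset_antisym)
  next
    assume "A = B"
    then show "hausdorff_dist A B = 0"
      using bodies2D[OF B] by (simp add: hausdorff_dist_def)
  qed
next
  fix A B C assume "A \<in> bodies2" "B \<in> bodies2" "C \<in> bodies2"
  then show "hausdorff_dist A C \<le> hausdorff_dist A B + hausdorff_dist B C"
    using infdist_triangle_hausdorff[of A B C] infdist_triangle_hausdorff[of C B A]
    by (intro hausdorff_dist_le)
      (auto simp: bodies2D hausdorff_dist_commute add.commute)
qed

section \<open>Meagre sets\<close>

definition nowhere_dense_in :: "'a topology \<Rightarrow> 'a set \<Rightarrow> bool" where
  "nowhere_dense_in X S \<longleftrightarrow>
     S \<subseteq> topspace X \<and>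
     (\<forall>U. openin X U \<and> U \<noteq> {} \<longrightarrow> (\<exists>V. openin X V \<and> V \<noteq> {} \<and> V \<subseteq> U \<and> V \<inter> S = {}))"

definition meagre_in :: "'a topology \<Rightarrow> 'a set \<Rightarrow> bool" where
  "meagre_in X S \<longleftrightarrow>
     (\<exists>\<F>. countable \<F> \<and> (\<forall>T\<in>\<F>. nowhere_dense_in X T) \<and> S = \<Union>\<F>)"

definition for_all_norms_besides_meagre :: "((real ^ 2 \<Rightarrow> real) \<Rightarrow> bool) \<Rightarrow> bool" where
  "for_all_norms_besides_meagre P \<longleftrightarrow>
     meagre_in Hausdorff.mtopology {unit_ball N | N. is_norm N \<and> \<not> P N}"

section \<open>Chromatic number and unit distance graphs\<close>

text \<open>A graph is given by its vertex set and its adjacency relation.\<close>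

definition proper_colouring :: "'v set \<Rightarrow> ('v \<Rightarrow> 'v \<Rightarrow> bool) \<Rightarrow> nat \<Rightarrow> ('v \<Rightarrow> nat) \<Rightarrow> bool" where
  "proper_colouring V adj k c \<longleftrightarrow>
     c ` V \<subseteq> {..<k} \<and> (\<forall>x\<in>V. \<forall>y\<in>V. adj x y \<longrightarrow> c x \<noteq> c y)"

text \<open>The value is \<open>\<infinity>\<close> when no finite number of colours suffices.\<close>

definition chromatic_number :: "'v set \<Rightarrow> ('v \<Rightarrow> 'v \<Rightarrow> bool) \<Rightarrow> enat" where
  "chromatic_number V adj = Inf {enat k | k. \<exists>c. proper_colouring V adj k c}"

definition unit_distance_adj :: "('a::real_vector \<Rightarrow> real) \<Rightarrow> 'a \<Rightarrow> 'a \<Rightarrow> bool" where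
  "unit_distance_adj N x y \<longleftrightarrow> N (x - y) = 1"

end

theory Submission
  imports Defs
begin

text \<open>
  Four colours are always necessary, and for a typical norm they are sufficient.

  \<^bold>\<open>Lower bound, for every norm.\<close> If \<open>0\<close>, \<open>u\<close>, \<open>v\<close> are at mutual distance 1, then so are \<open>u\<close>, \<open>v\<close>,
  \<open>u + v\<close>, so in a 3-colouring the tip \<open>u + v\<close> of this rhombus has the colour of \<open>0\<close>. It therefore
  suffices to find two tips at distance 1 (\<open>rhombus_tips_at_unit_distance\<close>), which gives a copy of
  the Moser spindle. The set of positively oriented triangles \<open>(0, u, v)\<close> is compact and projects
  onto the unit circle with convex nonempty fibres, hence it is connected. The distance of a moving
  tip from a fixed tip \<open>s\<close> vanishes at \<open>s\<close> and is \<open>2 * N s \<ge> 2\<close> at \<open>- s\<close>, so it is 1 somewhere.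

  \<^bold>\<open>Upper bound.\<close> Suppose that every finite set \<open>W\<close> of unit vectors, no two of them opposite, satisfies
  \<open>card W \<le> 2 * dim W\<close>, where \<open>dim\<close> is the dimension of the span over the rationals. By the matroid
  partition theorem and compactness, a half of the unit circle splits into two sets that are linearly
  independent over the rationals. For each of the two there is an additive map to the rationals
  with value 1 on the set. Moving by a unit vector changes the parity of the floor of one of
  the two maps, so the pair of parities is a proper 4-colouring (\<open>four_colouring\<close>).

  \<^bold>\<open>Genericity.\<close> If the inequality fails, some \<open>k\<close> unit vectors have \<open>2 * k + 1\<close> rational linear
  combinations that are again unit vectors and pairwise far from equal or opposite: a
  \<open>coincidence\<close>. There are countably many choices of \<open>k\<close>, of the coefficients, and of a
  separation \<open>1 / Suc n\<close>. For each of them the norms with a coincidence are nowhere dense. Norms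
  without one form an open set by compactness (\<open>no_coincidence_stable\<close>). To see that they are dense,
  approximate the given norm by a uniformly convex one, and this one by a polygonal one. Its edges
  are shorter than the separation, so that the \<open>2 * k + 1\<close> unit vectors lie, up to sign, on distinct edge lines. If
  the distances of these lines from the origin are generic, the resulting \<open>2 * k + 1\<close> linear
  equations in \<open>2 * k\<close> unknown coordinates are inconsistent (\<open>weights_avoiding_coincidences\<close>).
\<close>

section \<open>Partition into two independent sets\<close>

text \<open>
  The axioms of a matroid rank function, for integer values so that contraction needs no truncated
  subtraction.
\<close>

definition rank_function :: "('a set \<Rightarrow> int) \<Rightarrow> bool" where
  "rank_function r \<longleftrightarrow> r {} = 0 \<and> (\<forall>A B. finite B \<longrightarrow> A \<subseteq> B \<longrightarrow> r A \<le> r B) \<and>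
     (\<forall>A B. finite A \<longrightarrow> finite B \<longrightarrow> r (A \<union> B) + r (A \<inter> B) \<le> r A + r B) \<and> (\<forall>x. r {x} \<le> 1)"

lemma rank_function_mono:
  assumes "rank_function r" "finite B" "A \<subseteq> B"
  shows "r A \<le> r B"
  using assms unfolding rank_function_def by blast

lemma rank_function_submodular:
  assumes "rank_function r" "finite A" "finite B"
  shows "r (A \<union> B) + r (A \<inter> B) \<le> r A + r B"
  using assms unfolding rank_function_def by simp

lemma rank_function_nonneg: assumes "rank_function r" "finite A" shows "0 \<le> r A"
proof -
  have "r {} \<le> r A" "r {} = 0" using assms empty_subsetI[of A] unfolding rank_function_def by blast+
  then show ?thesis by simp
qed

text \<open>
  The rank function of the matroid contracted at a non-loop \<open>e\<close>.
\<close>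

lemma rank_function_contract:
  assumes "rank_function r" "r {e} = 1"
  shows "rank_function (\<lambda>A. r (insert e A) - 1)"
  unfolding rank_function_def
proof (intro conjI allI impI)
  show "r (insert e A) - 1 \<le> r (insert e B) - 1" if "finite B" "A \<subseteq> B" for A B
    using rank_function_mono[OF assms(1) _ insert_mono[OF that(2)], of e] that(1) by simp
  show "r (insert e (A \<union> B)) - 1 + (r (insert e (A \<inter> B)) - 1)
      \<le> r (insert e A) - 1 + (r (insert e B) - 1)" if "finite A" "finite B" for A B
  proof -
    have "r (insert e A \<union> insert e B) + r (insert e A \<inter> insert e B) \<le> r (insert e A) + r (insert e B)"
      using that by (intro rank_function_submodular[OF assms(1)]) simp_all
    then show ?thesis by simp
  qed
  show "r {e, x} - 1 \<le> 1" for x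
  proof -
    have "r ({e} \<union> {x}) + r ({e} \<inter> {x}) \<le> r {e} + r {x}"
      using assms(1) unfolding rank_function_def by blast
    moreover have "0 \<le> r ({e} \<inter> {x})" by (intro rank_function_nonneg assms(1)) simp
    moreover have "r {x} \<le> 1" using assms(1) unfolding rank_function_def by blast
    ultimately show ?thesis using assms(2) by (simp add: insert_commute)
  qed
qed (use assms in simp)

text \<open>
  Induction on \<open>E\<close>: an element \<open>e\<close> is put into the first part, contracting
  it in the first matroid, or into the second part, contracting it in the second matroid. If both
  choices violated the hypothesis, by sets \<open>A\<close> and \<open>B\<close> respectively, then
  submodularity of both rank functions, summed, would contradict the hypothesis for \<open>insert e
  (A \<union> B)\<close> and \<open>A \<inter> B\<close>.
\<close>

theorem matroid_partition:
  fixes r\<^sub>1 r\<^sub>2 :: "'a set \<Rightarrow> int"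
  assumes "finite E" "rank_function r\<^sub>1" "rank_function r\<^sub>2"
    and "\<And>A. A \<subseteq> E \<Longrightarrow> int (card A) \<le> r\<^sub>1 A + r\<^sub>2 A"
  shows "\<exists>I\<subseteq>E. r\<^sub>1 I = card I \<and> r\<^sub>2 (E - I) = card (E - I)"
  using assms
proof (induction E arbitrary: r\<^sub>1 r\<^sub>2 rule: finite_induct)
  case empty
  then show ?case by (auto simp: rank_function_def)
next
  case (insert e E)
  note r = insert.prems(1,2)
  have fin: "finite A" if "A \<subseteq> E" for A
    using that insert.hyps(1) finite_subset by blast
  have pos: "r {e} = 1" if "rank_function r" "r {e} \<noteq> 0" for r :: "'a set \<Rightarrow> int"
  proof -
    have "0 \<le> r {e}" by (intro rank_function_nonneg that(1)) simp
    moreover have "r {e} \<le> 1" using that(1) unfolding rank_function_def by blast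
    ultimately show ?thesis using that(2) by linarith
  qed
  define good where "good r r' \<longleftrightarrow> (r::'a set \<Rightarrow> int) {e} = 1 \<and> (\<forall>A\<subseteq>E. int (card A) \<le> r (insert e A) - 1 + r' A)"
    for r r' :: "'a set \<Rightarrow> int"
  have bad: "\<exists>A\<subseteq>E. r (insert e A) + r' A \<le> int (card A)"
    if rr: "rank_function r" "rank_function r'" "\<not> good r r'" for r r' :: "'a set \<Rightarrow> int"
  proof (cases "r {e} = 0")
    case True
    then show ?thesis using rr(2) unfolding rank_function_def by (intro exI[of _ "{}"]) simp
  next
    case False
    then have "r {e} = 1" using pos rr(1) by simp
    then obtain A where "A \<subseteq> E" "\<not> int (card A) \<le> r (insert e A) - 1 + r' A"
      using rr(3) unfolding good_def by auto
    then show ?thesis by (intro exI[of _ A]) auto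
  qed
  have "good r\<^sub>1 r\<^sub>2 \<or> good r\<^sub>2 r\<^sub>1"
  proof (rule ccontr)
    assume "\<not> (good r\<^sub>1 r\<^sub>2 \<or> good r\<^sub>2 r\<^sub>1)"
    then have ng: "\<not> good r\<^sub>1 r\<^sub>2" "\<not> good r\<^sub>2 r\<^sub>1" by auto
    obtain A where A: "A \<subseteq> E" "r\<^sub>1 (insert e A) + r\<^sub>2 A \<le> int (card A)"
      using bad[OF r ng(1)] by auto
    obtain B where B: "B \<subseteq> E" "r\<^sub>2 (insert e B) + r\<^sub>1 B \<le> int (card B)"
      using bad[OF r(2,1) ng(2)] by auto
    have AB: "finite A" "finite B" "e \<notin> A" "e \<notin> B" using A B fin insert.hyps by auto
    have "r\<^sub>1 (insert e A \<union> B) + r\<^sub>1 (insert e A \<inter> B) \<le> r\<^sub>1 (insert e A) + r\<^sub>1 B"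
      by (rule rank_function_submodular[OF r(1)]) (use AB in auto)
    moreover have "r\<^sub>2 (A \<union> insert e B) + r\<^sub>2 (A \<inter> insert e B) \<le> r\<^sub>2 A + r\<^sub>2 (insert e B)"
      by (rule rank_function_submodular[OF r(2)]) (use AB in auto)
    moreover have "insert e A \<inter> B = A \<inter> B" "A \<inter> insert e B = A \<inter> B"
      "insert e A \<union> B = insert e (A \<union> B)" "A \<union> insert e B = insert e (A \<union> B)"
      using AB by auto
    moreover have "int (card (insert e (A \<union> B))) \<le> r\<^sub>1 (insert e (A \<union> B)) + r\<^sub>2 (insert e (A \<union> B))"
      by (rule insert.prems(3)) (use A B in auto)
    moreover have "int (card (A \<inter> B)) \<le> r\<^sub>1 (A \<inter> B) + r\<^sub>2 (A \<inter> B)"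
      by (rule insert.prems(3)) (use A B in auto)
    moreover have "card (insert e (A \<union> B)) = Suc (card (A \<union> B))" using AB by simp
    moreover have "card A + card B = card (A \<union> B) + card (A \<inter> B)"
      by (rule card_Un_Int) (use AB in auto)
    ultimately show False using A(2) B(2) by simp
  qed
  then show ?case
  proof
    assume g: "good r\<^sub>1 r\<^sub>2"
    then have "r\<^sub>1 {e} = 1" unfolding good_def by simp
    then have "rank_function (\<lambda>A. r\<^sub>1 (insert e A) - 1)"
      by (rule rank_function_contract[OF r(1)])
    moreover have "int (card A) \<le> r\<^sub>1 (insert e A) - 1 + r\<^sub>2 A" if "A \<subseteq> E" for A
      using g that unfolding good_def by simp
    ultimately obtain I where I: "I \<subseteq> E" "r\<^sub>1 (insert e I) - 1 = card I"
      "r\<^sub>2 (E - I) = card (E - I)" using insert.IH[of "\<lambda>A. r\<^sub>1 (insert e A) - 1" r\<^sub>2] r(2) by blast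
    have "insert e E - insert e I = E - I" using insert.hyps I by auto
    moreover have "card (insert e I) = Suc (card I)"
      using I(1) fin[OF I(1)] insert.hyps(2) by (intro card_insert_disjoint) auto
    ultimately have "r\<^sub>1 (insert e I) = int (card (insert e I))"
      "r\<^sub>2 (insert e E - insert e I) = int (card (insert e E - insert e I))" using I(2,3) by simp_all
    then show ?thesis using I(1) insert_mono by meson
  next
    assume g: "good r\<^sub>2 r\<^sub>1"
    then have "r\<^sub>2 {e} = 1" unfolding good_def by simp
    then have "rank_function (\<lambda>A. r\<^sub>2 (insert e A) - 1)"
      by (rule rank_function_contract[OF r(2)])
    moreover have "int (card A) \<le> r\<^sub>1 A + (r\<^sub>2 (insert e A) - 1)" if "A \<subseteq> E" for A
      using g that unfolding good_def by (simp add: add.commute)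
    ultimately obtain I where I: "I \<subseteq> E" "r\<^sub>1 I = card I"
      "r\<^sub>2 (insert e (E - I)) - 1 = card (E - I)"
      using insert.IH[of r\<^sub>1 "\<lambda>A. r\<^sub>2 (insert e A) - 1"] r(1) by blast
    have "insert e E - I = insert e (E - I)" using insert.hyps I by auto
    moreover have "card (insert e (E - I)) = Suc (card (E - I))"
      using insert.hyps by (intro card_insert_disjoint) auto
    ultimately have "r\<^sub>2 (insert e E - I) = int (card (insert e E - I))" using I(3) by simp
    then show ?thesis using I(1,2) subset_insertI2 by meson
  qed
qed

context vector_space
begin

lemma dim_mono_finite:
  assumes "finite T" "S \<subseteq> T" shows "dim S \<le> dim T"
proof -
  obtain B where B: "B \<subseteq> T" "independent B" "T \<subseteq> span B" "card B = dim T"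
    using basis_exists by blast
  then show ?thesis
    using dim_le_card[of S B] assms finite_subset by (metis order_trans)
qed

text \<open>
  A basis \<open>I\<close> of the intersection extends to a basis \<open>J\<close> of
  \<open>A\<close> and to a basis \<open>K\<close> of \<open>B\<close>; then \<open>J \<union>
  K\<close> spans the union and \<open>J \<inter> K\<close> contains \<open>I\<close>.
\<close>

lemma dim_submodular:
  assumes "finite A" "finite B"
  shows "dim (A \<union> B) + dim (A \<inter> B) \<le> dim A + dim B"
proof -
  obtain I where I: "I \<subseteq> A \<inter> B" "independent I" "A \<inter> B \<subseteq> span I" "card I = dim (A \<inter> B)"
    using basis_exists by blast
  obtain J where J: "I \<subseteq> J" "J \<subseteq> A" "independent J" "A \<subseteq> span J"
    using maximal_independent_subset_extend[of I A] I by auto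
  obtain K where K: "I \<subseteq> K" "K \<subseteq> B" "independent K" "B \<subseteq> span K"
    using maximal_independent_subset_extend[of I B] I by auto
  have fin: "finite J" "finite K" using J K assms finite_subset by blast+
  have "A \<union> B \<subseteq> span (J \<union> K)"
    using J(4) K(4) span_mono[of J "J \<union> K"] span_mono[of K "J \<union> K"] by blast
  then have "dim (A \<union> B) \<le> card (J \<union> K)" using fin by (intro dim_le_card) auto
  moreover have "card (J \<union> K) + card I \<le> card (J \<union> K) + card (J \<inter> K)"
    using I J K fin by (intro add_left_mono card_mono) auto
  moreover have "card (J \<union> K) + card (J \<inter> K) = card J + card K"
    using card_Un_Int fin by metis
  moreover have "card J = dim A" "card K = dim B" using J K basis_card_eq_dim by blast+
  ultimately show ?thesis using I by linarith
qed

lemma independent_if_dim_eq_card: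
  assumes "finite A" "dim A = card A" shows "independent A"
proof -
  obtain B where B: "B \<subseteq> A" "independent B" "A \<subseteq> span B" "card B = dim A"
    using basis_exists by blast
  then show ?thesis using assms card_subset_eq by metis
qed

lemma rank_function_dim: "rank_function (\<lambda>A. int (dim A))"
  unfolding rank_function_def
proof (intro conjI allI impI)
  show "int (dim {}) = 0" using dim_le_card[of "{}" "{}"] by simp
  show "int (dim {x}) \<le> 1" for x using dim_le_card[OF span_superset, of "{x}"] by simp
  show "int (dim A) \<le> int (dim B)" if "finite B" "A \<subseteq> B" for A B
    using dim_mono_finite[OF that] by simp
  show "int (dim (A \<union> B)) + int (dim (A \<inter> B)) \<le> int (dim A) + int (dim B)"
    if "finite A" "finite B" for A B
    using dim_submodular[OF that] by linarith
qed

lemma partition_into_two_independent_finite: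
  assumes "finite W" "\<And>A. A \<subseteq> W \<Longrightarrow> card A \<le> 2 * dim A"
  shows "\<exists>I\<subseteq>W. independent I \<and> independent (W - I)"
proof -
  have "int (card A) \<le> int (dim A) + int (dim A)" if "A \<subseteq> W" for A
    using assms(2)[OF that] by linarith
  from matroid_partition[OF assms(1) rank_function_dim rank_function_dim this] show ?thesis
    using independent_if_dim_eq_card assms(1) by (metis finite_Diff of_nat_eq_iff finite_subset)
qed

text \<open>
  Compactness of the space of all 2-colourings of the vectors reduces an infinite set to its finite
  subsets: whether a 2-colouring is good on a finite \<open>W\<close> is a closed condition, since
  it involves only finitely many coordinates, and linear dependence is always witnessed by a finite
  set.
\<close>

lemma partition_into_two_independent:
  assumes "\<And>W. W \<subseteq> H \<Longrightarrow> finite W \<Longrightarrow> card W \<le> 2 * dim W"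
  shows "\<exists>I\<subseteq>H. independent I \<and> independent (H - I)"
proof -
  define C where "C W = {\<sigma>. independent {u\<in>W. \<sigma> u} \<and> independent {u\<in>W. \<not> \<sigma> u}}" for W
  have closed_coord: "closed {\<sigma> :: 'b \<Rightarrow> bool. \<sigma> u = b}" for u b
  proof -
    have "closed ((\<lambda>\<sigma> :: 'b \<Rightarrow> bool. \<sigma> u) -` {b})"
      by (intro closed_vimage continuous_on_product_coordinates) (auto simp: closed_def open_discrete)
    then show ?thesis by (simp add: vimage_def)
  qed
  have closed_C: "closed (C W)" if "finite W" for W
  proof -
    have "C W = (\<Union>S\<in>{S. S \<subseteq> W \<and> independent S \<and> independent (W - S)}. \<Inter>u\<in>W. {\<sigma>. \<sigma> u = (u \<in> S)})"
      (is "_ = ?R")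
    proof (intro equalityI subsetI)
      fix \<sigma> assume "\<sigma> \<in> C W"
      moreover have "W - {u\<in>W. \<sigma> u} = {u\<in>W. \<not> \<sigma> u}" by auto
      ultimately show "\<sigma> \<in> ?R" unfolding C_def by (intro UN_I[of "{u\<in>W. \<sigma> u}"]) auto
    next
      fix \<sigma> assume "\<sigma> \<in> ?R"
      then obtain S where S: "S \<subseteq> W" "independent S" "independent (W - S)" "\<forall>u\<in>W. \<sigma> u = (u \<in> S)"
        by auto
      then have "{u\<in>W. \<sigma> u} = S" "{u\<in>W. \<not> \<sigma> u} = W - S" by auto
      then show "\<sigma> \<in> C W" using S unfolding C_def by simp
    qed
    also have "closed \<dots>"
      using that by (intro closed_UN closed_INT ballI closed_coord) auto
    finally show ?thesis .
  qed
  have "compactin (product_topology (\<lambda>i::'b. euclidean :: bool topology) UNIV) (PiE UNIV (\<lambda>_. UNIV))"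
    unfolding compactin_PiE by (auto simp: finite_imp_compact)
  then have comp: "compact (UNIV :: ('b \<Rightarrow> bool) set)"
    using compactin_euclidean_iff[of "UNIV :: ('b \<Rightarrow> bool) set"]
    by (simp add: euclidean_product_topology PiE_UNIV_domain)
  have fip: "UNIV \<inter> (\<Inter>W\<in>F. C W) \<noteq> {}" if F: "finite F" "F \<subseteq> {W. W \<subseteq> H \<and> finite W}" for F
  proof -
    have U: "finite (\<Union>F)" "\<Union>F \<subseteq> H" using F by auto
    have "card A \<le> 2 * dim A" if "A \<subseteq> \<Union>F" for A
      using that U assms finite_subset by (metis subset_trans)
    from partition_into_two_independent_finite[OF U(1) this]
    obtain I where I: "I \<subseteq> \<Union>F" "independent I" "independent (\<Union>F - I)" by auto
    have "(\<lambda>u. u \<in> I) \<in> C W" if "W \<in> F" for W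
    proof -
      have "{u\<in>W. u \<in> I} \<subseteq> I" "{u\<in>W. u \<notin> I} \<subseteq> \<Union>F - I" using that by auto
      then show ?thesis using I independent_mono unfolding C_def by blast
    qed
    then show ?thesis by blast
  qed
  have "UNIV \<inter> (\<Inter>W\<in>{W. W \<subseteq> H \<and> finite W}. C W) \<noteq> {}"
    by (rule compact_imp_fip_image[OF comp _ fip]) (simp_all add: closed_C)
  then obtain \<sigma> where \<sigma>: "\<And>W. W \<subseteq> H \<Longrightarrow> finite W \<Longrightarrow> \<sigma> \<in> C W" by auto
  have ind_S: "independent S" if S: "S \<subseteq> H" "\<And>u v. u \<in> S \<Longrightarrow> v \<in> S \<Longrightarrow> \<sigma> u = \<sigma> v" for S
  proof
    assume "dependent S"
    then obtain T w where T: "finite T" "T \<subseteq> S" "(\<Sum>v\<in>T. scale (w v) v) = 0" "\<exists>v\<in>T. w v \<noteq> 0"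
      unfolding dependent_explicit by auto
    then have "dependent T" unfolding dependent_explicit by (intro exI[of _ T] exI[of _ w]) simp
    moreover have "\<sigma> \<in> C T" using T(2) S(1) by (intro \<sigma> T(1)) auto
    then have ind: "independent {u\<in>T. \<sigma> u}" "independent {u\<in>T. \<not> \<sigma> u}" unfolding C_def by simp_all
    have "independent T"
    proof (cases "\<exists>v\<in>T. \<sigma> v")
      case True
      then have "\<sigma> u" if "u \<in> T" for u using S(2) T(2) that by (metis subsetD)
      then have eq: "{u\<in>T. \<sigma> u} = T" by auto
      show ?thesis using ind(1) unfolding eq .
    next
      case False
      then have eq: "{u\<in>T. \<not> \<sigma> u} = T" by auto
      show ?thesis using ind(2) unfolding eq .
    qed
    ultimately show False by simp
  qed
  have "independent {u\<in>H. \<sigma> u}" by (rule ind_S) simp_all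
  moreover have "independent (H - {u\<in>H. \<sigma> u})" by (rule ind_S) simp_all
  ultimately show ?thesis
    by (intro exI[of _ "{u\<in>H. \<sigma> u}"] conjI) simp_all
qed

end

section \<open>Norms on Euclidean spaces\<close>

lemma is_normD:
  assumes "is_norm N"
  shows is_norm_nonneg: "0 \<le> N x"
    and is_norm_eq_0: "N x = 0 \<longleftrightarrow> x = 0"
    and is_norm_scale: "N (r *\<^sub>R x) = \<bar>r\<bar> * N x"
    and is_norm_triangle: "N (x + y) \<le> N x + N y"
  using assms unfolding is_norm_def by auto

lemma is_norm_uminus: assumes "is_norm N" shows "N (- x) = N x"
  using is_norm_scale[OF assms, of "-1" x] by simp

lemma is_norm_minus_commute: assumes "is_norm N" shows "N (x - y) = N (y - x)"
  using is_norm_uminus[OF assms, of "x - y"] by simp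

lemma is_norm_0: assumes "is_norm N" shows "N 0 = 0"
  using is_norm_eq_0[OF assms] by simp

lemma is_norm_diff_ge: assumes "is_norm N" shows "\<bar>N x - N y\<bar> \<le> N (x - y)"
  using is_norm_triangle[OF assms, of "x - y" y] is_norm_triangle[OF assms, of "y - x" x]
    is_norm_minus_commute[OF assms, of x y] by simp

lemma is_norm_convex_combination:
  assumes "is_norm N" "0 \<le> s" "s \<le> 1"
  shows "N ((1 - s) *\<^sub>R x + s *\<^sub>R y) \<le> (1 - s) * N x + s * N y"
  using is_norm_triangle[OF assms(1), of "(1-s) *\<^sub>R x" "s *\<^sub>R y"] assms(2,3)
  by (simp add: is_norm_scale[OF assms(1)])

lemma is_norm_le_norm:
  fixes N :: "'a::euclidean_space \<Rightarrow> real"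
  assumes "is_norm N"
  obtains C where "C > 0" "\<And>x. N x \<le> C * norm x"
proof
  define C where "C = (\<Sum>b\<in>Basis. N b) + 1"
  show "C > 0" unfolding C_def by (intro add_nonneg_pos sum_nonneg is_norm_nonneg[OF assms]) auto
  show "N x \<le> C * norm x" for x
  proof -
    have *: "N (\<Sum>b\<in>S. (x \<bullet> b) *\<^sub>R b) \<le> (\<Sum>b\<in>S. N b) * norm x" if "finite S" "S \<subseteq> Basis" for S
      using that
    proof (induction S rule: finite_induct)
      case empty
      then show ?case by (simp add: is_norm_0[OF assms])
    next
      case (insert b S)
      have "N ((x \<bullet> b) *\<^sub>R b) \<le> N b * norm x"
        using Basis_le_norm[of b x] insert.prems is_norm_nonneg[OF assms, of b]
        by (simp add: is_norm_scale[OF assms] mult.commute mult_left_mono)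
      then show ?case
        using insert is_norm_triangle[OF assms, of "(x \<bullet> b) *\<^sub>R b" "\<Sum>b\<in>S. (x \<bullet> b) *\<^sub>R b"]
        by (simp add: distrib_right)
    qed
    have "N x \<le> (\<Sum>b\<in>Basis. N b) * norm x"
      using *[of Basis] by (simp add: euclidean_representation)
    then show ?thesis unfolding C_def by (simp add: distrib_right add_increasing2)
  qed
qed

lemma is_norm_continuous_on:
  fixes N :: "'a::euclidean_space \<Rightarrow> real"
  assumes "is_norm N"
  shows "continuous_on S N"
proof -
  obtain C where C: "C > 0" "\<And>x. N x \<le> C * norm x" using is_norm_le_norm[OF assms] by metis
  have "C-lipschitz_on UNIV N"
  proof (rule lipschitz_onI)
    show "dist (N x) (N y) \<le> C * dist x y" for x y
      using is_norm_diff_ge[OF assms, of x y] C(2)[of "x - y"] by (simp add: dist_norm)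
  qed (use C in simp)
  then show ?thesis using lipschitz_on_continuous_on continuous_on_subset by blast
qed

lemma is_norm_compose_continuous_on:
  fixes N :: "'a::euclidean_space \<Rightarrow> real"
  assumes "is_norm N" "continuous_on S f"
  shows "continuous_on S (\<lambda>x. N (f x))"
  using continuous_on_compose2[OF is_norm_continuous_on[OF assms(1), of UNIV] assms(2)] by simp

lemma is_norm_ge_norm:
  fixes N :: "'a::euclidean_space \<Rightarrow> real"
  assumes "is_norm N"
  obtains c where "c > 0" "\<And>x. c * norm x \<le> N x"
proof -
  obtain z where z: "z \<in> sphere 0 1" "\<And>x. x \<in> sphere 0 1 \<Longrightarrow> N z \<le> N x"
    using continuous_attains_inf[OF compact_sphere _ is_norm_continuous_on[OF assms], of 0 1]
    by auto
  show ?thesis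
  proof
    show "N z > 0" using z(1) is_norm_eq_0[OF assms, of z] is_norm_nonneg[OF assms, of z] by force
    show "N z * norm x \<le> N x" for x
    proof (cases "x = 0")
      case False
      then have "N z \<le> N (inverse (norm x) *\<^sub>R x)" by (intro z(2)) simp
      then show ?thesis using False by (simp add: is_norm_scale[OF assms] field_simps)
    qed (simp add: is_norm_0[OF assms])
  qed
qed

lemma unit_ball_in_bodies2:
  assumes "is_norm N" shows "unit_ball N \<in> bodies2"
proof -
  obtain c where c: "c > 0" "\<And>x. c * norm x \<le> N x" using is_norm_ge_norm[OF assms] by metis
  obtain C where C: "C > 0" "\<And>x. N x \<le> C * norm x" using is_norm_le_norm[OF assms] by metis
  have "closed (unit_ball N)" unfolding unit_ball_def
    by (intro closed_Collect_le is_norm_continuous_on[OF assms] continuous_on_const)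
  moreover have "bounded (unit_ball N)"
  proof (rule boundedI[of _ "1/c"])
    fix x assume "x \<in> unit_ball N"
    then show "norm x \<le> 1/c" using c(2)[of x] c(1) unfolding unit_ball_def by (simp add: field_simps)
  qed
  moreover have "convex (unit_ball N)" unfolding convex_alt unit_ball_def
  proof (intro ballI allI impI, elim conjE, unfold mem_Collect_eq)
    fix x y and s :: real assume "N x \<le> 1" "N y \<le> 1" "0 \<le> s" "s \<le> 1"
    then show "N ((1 - s) *\<^sub>R x + s *\<^sub>R y) \<le> 1"
      using is_norm_convex_combination[OF assms, of s x y]
        mult_left_mono[of "N x" 1 "1 - s"] mult_left_mono[of "N y" 1 s] by simp
  qed
  moreover have "\<forall>x\<in>unit_ball N. - x \<in> unit_ball N"
    unfolding unit_ball_def by (simp add: is_norm_uminus[OF assms])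
  moreover have "0 \<in> interior (unit_ball N)"
  proof (rule interiorI[of "ball 0 (1/C)"])
    show "ball 0 (1/C) \<subseteq> unit_ball N"
    proof
      fix x :: "real^2" assume "x \<in> ball 0 (1/C)"
      then have "C * norm x \<le> 1" using C(1) by (simp add: field_simps)
      then show "x \<in> unit_ball N" using C(2)[of x] unfolding unit_ball_def by simp
    qed
  qed (use C in auto)
  ultimately show ?thesis unfolding bodies2_def by blast
qed

text \<open>
  A hyperplane that separates \<open>p\<close> from the open unit ball, scaled to have value 1 at
  \<open>p\<close>.
\<close>

lemma is_norm_supporting_functional:
  fixes N :: "'a::euclidean_space \<Rightarrow> real"
  assumes "is_norm N" "N p = 1"
  obtains y where "y \<bullet> p = 1" "\<And>x. \<bar>y \<bullet> x\<bar> \<le> N x"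
proof -
  let ?S = "{x. N x < 1}"
  have "convex ?S" unfolding convex_alt
  proof (intro ballI allI impI, elim conjE, unfold mem_Collect_eq)
    fix x y and s :: real assume *: "N x < 1" "N y < 1" "0 \<le> s" "s \<le> 1"
    have "(1 - s) * N x + s * N y < 1" using * by (rule_tac convex_bound_lt) auto
    then show "N ((1 - s) *\<^sub>R x + s *\<^sub>R y) < 1"
      using is_norm_convex_combination[OF assms(1), of s x y] * by simp
  qed
  moreover have "0 \<in> ?S" by (simp add: is_norm_0[OF assms(1)])
  then have "?S \<noteq> {}" by blast
  ultimately obtain a b where ab: "a \<noteq> 0" "\<And>x. N x < 1 \<Longrightarrow> a \<bullet> x \<le> b" "b \<le> a \<bullet> p"
    using separating_hyperplane_sets[of ?S "{p}"] assms(2) by auto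
  (* Scaling x to norm slightly below 1 compares a with the bound b on the open unit ball. *)
  have N_le: "a \<bullet> x \<le> b * N x" if "a \<bullet> x > 0" for x
  proof (rule field_le_epsilon)
    fix e :: real assume "e > 0"
    define t where "t = N x + e / (1 + \<bar>b\<bar>)"
    have "e / (1 + \<bar>b\<bar>) > 0" using \<open>e > 0\<close> by simp
    then have t: "N x < t" "t > 0" unfolding t_def using is_norm_nonneg[OF assms(1), of x] by linarith+
    then have "a \<bullet> (inverse t *\<^sub>R x) \<le> b"
      by (intro ab(2)) (simp add: is_norm_scale[OF assms(1)] field_simps)
    then have "a \<bullet> x \<le> b * t" using t by (simp add: field_simps)
    also have "\<dots> = b * N x + e * (b / (1 + \<bar>b\<bar>))" unfolding t_def by (simp add: field_simps)
    also have "\<dots> \<le> b * N x + e * 1"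
      using \<open>e > 0\<close> by (intro add_left_mono mult_left_mono) (auto simp: field_simps)
    finally show "a \<bullet> x \<le> b * N x + e" by simp
  qed
  have "0 < a \<bullet> a" using ab(1) by simp
  then have "0 < b * N a" using N_le[of a] by linarith
  then have b: "b > 0" using is_norm_nonneg[OF assms(1), of a] by (simp add: zero_less_mult_iff)
  have le: "a \<bullet> x \<le> b * N x" for x
    using N_le[of x] mult_nonneg_nonneg[of b "N x"] b is_norm_nonneg[OF assms(1), of x] by linarith
  have "a \<bullet> p = b" using le[of p] ab(3) assms(2) by simp
  show ?thesis
  proof
    show "(inverse b *\<^sub>R a) \<bullet> p = 1" using \<open>a \<bullet> p = b\<close> b by simp
    show "\<bar>(inverse b *\<^sub>R a) \<bullet> x\<bar> \<le> N x" for x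
      using le[of x] le[of "-x"] b by (simp add: is_norm_uminus[OF assms(1)] abs_le_iff field_simps)
  qed
qed

section \<open>Colouring by two rational functionals\<close>

interpretation rational: vector_space "\<lambda>(q::rat) (x::'a::real_vector). of_rat q *\<^sub>R x"
  by unfold_locales (simp_all add: of_rat_add of_rat_mult algebra_simps)

interpretation rational_functional:
  vector_space_pair "\<lambda>(q::rat) (x::'a::real_vector). of_rat q *\<^sub>R x" "(*) :: rat \<Rightarrow> rat \<Rightarrow> rat"
  by unfold_locales (simp_all add: algebra_simps)

lemma rational_independent_imp_additive_functional:
  fixes I :: "'a::real_vector set"
  assumes "rational.independent I"
  shows "\<exists>f :: 'a \<Rightarrow> rat. (\<forall>x y. f (x - y) = f x - f y) \<and> (\<forall>u\<in>I. f u = 1)"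
proof -
  obtain f :: "'a \<Rightarrow> rat" where f: "Vector_Spaces.linear (\<lambda>q x. of_rat q *\<^sub>R x) (*) f" "\<forall>u\<in>I. f u = 1"
    using rational_functional.linear_independent_extend[OF assms, of "\<lambda>_. 1"] by auto
  interpret Vector_Spaces.linear "\<lambda>(q::rat) (x::'a). of_rat q *\<^sub>R x" "(*)" f by (rule f(1))
  show ?thesis using f(2) diff by blast
qed

lemma floor_parity_differs:
  fixes a b :: rat
  assumes "\<bar>a - b\<bar> = 1"
  shows "even \<lfloor>a\<rfloor> \<noteq> even \<lfloor>b\<rfloor>"
proof -
  have "a = b + 1 \<or> b = a + 1" using assms by linarith
  then show ?thesis by auto
qed

text \<open>
  The edge vector \<open>x - y\<close> belongs, up to sign, to one of the two independent parts of
  \<open>H\<close>. The functional that is 1 on this part changes by exactly 1 along the edge, so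
  its floor changes parity.
\<close>

lemma four_colouring:
  fixes N :: "'a::real_vector \<Rightarrow> real"
  assumes "is_norm N"
    and H: "\<And>u. N u = 1 \<Longrightarrow> u \<in> H \<or> - u \<in> H"
    and dim: "\<And>W. W \<subseteq> H \<Longrightarrow> finite W \<Longrightarrow> card W \<le> 2 * rational.dim W"
  shows "\<exists>c. proper_colouring UNIV (unit_distance_adj N) 4 c"
proof -
  obtain I where I: "I \<subseteq> H" "rational.independent I" "rational.independent (H - I)"
    using rational.partition_into_two_independent[OF dim] by auto
  obtain f :: "'a \<Rightarrow> rat" where f: "(\<forall>x y. f (x - y) = f x - f y) \<and> (\<forall>u\<in>I. f u = 1)"
    using rational_independent_imp_additive_functional[OF I(2)] by (rule exE)
  obtain g :: "'a \<Rightarrow> rat" where g: "(\<forall>x y. g (x - y) = g x - g y) \<and> (\<forall>u\<in>H - I. g u = 1)"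
    using rational_independent_imp_additive_functional[OF I(3)] by (rule exE)
  define c where "c x = (if even \<lfloor>f x\<rfloor> then 0 else 1) + (if even \<lfloor>g x\<rfloor> then 0 else (2::nat))" for x
  have "c x \<noteq> c y" if "N (x - y) = 1" for x y
  proof -
    have one: "\<bar>f w\<bar> = 1 \<or> \<bar>g w\<bar> = 1" if "w \<in> H" for w
      using that f g by (cases "w \<in> I") simp_all
    have "\<bar>f x - f y\<bar> = 1 \<or> \<bar>g x - g y\<bar> = 1"
      using H[OF that]
    proof
      assume "x - y \<in> H"
      then show ?thesis using one[of "x - y"] by (simp add: f g)
    next
      assume "- (x - y) \<in> H"
      then show ?thesis using one[of "y - x"] by (simp add: f g abs_minus_commute)
    qed
    then have "even \<lfloor>f x\<rfloor> \<noteq> even \<lfloor>f y\<rfloor> \<or> even \<lfloor>g x\<rfloor> \<noteq> even \<lfloor>g y\<rfloor>"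
      using floor_parity_differs by blast
    then show ?thesis unfolding c_def by (auto split: if_splits)
  qed
  moreover have "c x < 4" for x unfolding c_def by auto
  ultimately show ?thesis unfolding proper_colouring_def unit_distance_adj_def by auto
qed

lemma chromatic_number_eqI:
  assumes "\<exists>c. proper_colouring V adj (Suc k) c" "\<nexists>c. proper_colouring V adj k c"
  shows "chromatic_number V adj = enat (Suc k)"
  unfolding chromatic_number_def
proof (rule antisym)
  show "Inf {enat k |k. \<exists>c. proper_colouring V adj k c} \<le> enat (Suc k)"
    using assms(1) by (intro Inf_lower) auto
  show "enat (Suc k) \<le> Inf {enat k |k. \<exists>c. proper_colouring V adj k c}"
  proof (intro Inf_greatest, clarify)
    fix l c assume "proper_colouring V adj l c"
    then have "proper_colouring V adj k c" if "l \<le> k"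
      using that unfolding proper_colouring_def by (meson lessThan_subset_iff subset_trans)
    then show "enat (Suc k) \<le> enat l" using assms(2) by (cases "l \<le> k") auto
  qed
qed

section \<open>Every norm contains a Moser spindle\<close>

lemma is_norm_interior_combination:
  assumes "is_norm N" "N z < 1" "N p \<le> 1" "0 \<le> l" "l < 1"
  shows "N ((1 - l) *\<^sub>R z + l *\<^sub>R p) < 1"
proof -
  have "N ((1 - l) *\<^sub>R z + l *\<^sub>R p) \<le> (1 - l) * N z + l * N p"
    using is_norm_convex_combination[OF assms(1)] assms by simp
  also have "\<dots> \<le> (1 - l) * N z + l * 1"
    using assms by (intro add_left_mono mult_left_mono) auto
  also have "\<dots> < (1 - l) * 1 + l * 1"
    using assms by (intro add_strict_right_mono mult_strict_left_mono) auto
  finally show ?thesis by simp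
qed

text \<open>
  The oriented area of the parallelogram spanned by \<open>u\<close> and \<open>v\<close>; for fixed
  \<open>u\<close> it measures the height of \<open>v\<close> above the line through
  \<open>u\<close>.
\<close>

definition area2 :: "real ^ 2 \<Rightarrow> real ^ 2 \<Rightarrow> real" where
  "area2 u v = u $ 1 * v $ 2 - u $ 2 * v $ 1"

lemma area2_eq_0_iff:
  assumes "u \<noteq> 0" shows "area2 u v = 0 \<longleftrightarrow> (\<exists>r. v = r *\<^sub>R u)"
proof
  assume h: "area2 u v = 0"
  then have eq: "u $ 1 * v $ 2 = u $ 2 * v $ 1" unfolding area2_def by simp
  have "u $ 1 \<noteq> 0 \<or> u $ 2 \<noteq> 0" using assms by (auto simp: vec_eq_iff forall_2)
  then show "\<exists>r. v = r *\<^sub>R u"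
  proof
    assume "u $ 1 \<noteq> 0"
    then show ?thesis using eq
      by (intro exI[of _ "v $ 1 / u $ 1"]) (simp add: vec_eq_iff forall_2 field_simps)
  next
    assume "u $ 2 \<noteq> 0"
    then show ?thesis using eq
      by (intro exI[of _ "v $ 2 / u $ 2"]) (simp add: vec_eq_iff forall_2 field_simps)
  qed
qed (auto simp: area2_def)

text \<open>
  The weak inequality makes the set of all triangles closed; it is strict for every apex over a unit
  vector.
\<close>

definition equilateral_apices :: "(real ^ 2 \<Rightarrow> real) \<Rightarrow> real ^ 2 \<Rightarrow> (real ^ 2) set" where
  "equilateral_apices N u = {v. N v = 1 \<and> N (v - u) = 1 \<and> 0 \<le> area2 u v}"

lemma equilateral_apices_area_pos:
  assumes "is_norm N" "N u = 1" "v \<in> equilateral_apices N u"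
  shows "0 < area2 u v"
proof -
  have "area2 u v \<noteq> 0"
  proof
    assume "area2 u v = 0"
    moreover have "u \<noteq> 0" using assms is_norm_0 by force
    ultimately obtain r where r: "v = r *\<^sub>R u" using area2_eq_0_iff by blast
    have "\<bar>r\<bar> = 1" using assms(2,3) r unfolding equilateral_apices_def
      by (simp add: is_norm_scale[OF assms(1)])
    moreover have "N ((r - 1) *\<^sub>R u) = 1" using assms(3) r unfolding equilateral_apices_def
      by (simp add: scaleR_left_diff_distrib)
    then have "\<bar>r - 1\<bar> = 1" using assms(2) by (simp add: is_norm_scale[OF assms(1)])
    ultimately show False by linarith
  qed
  then show ?thesis using assms(3) unfolding equilateral_apices_def by simp
qed

text \<open>
  All apices over \<open>u\<close> have the same height. The chord of the unit ball parallel to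
  \<open>u\<close> at the height of the lower apex \<open>v\<close> is longer than \<open>u\<close>,
  since the ball contains \<open>- u\<close>, \<open>u\<close> and the unit chord from \<open>v' -
  u\<close> to \<open>v'\<close> above it. The points \<open>v - u\<close> and \<open>v\<close> at
  distance 1 on this chord cannot both be boundary points: one of them lies on the segment from a
  point \<open>z\<close> interior to the ball to another point of the ball, without being that other
  point.
\<close>

lemma equilateral_apices_area_not_less:
  assumes N: "is_norm N" "N u = 1"
    and v: "v \<in> equilateral_apices N u" and v': "v' \<in> equilateral_apices N u"
  shows "\<not> area2 u v < area2 u v'"
proof
  assume less: "area2 u v < area2 u v'"
  define s where "s = area2 u v / area2 u v'"
  have pos: "0 < area2 u v" using equilateral_apices_area_pos[OF N v] .
  then have s: "0 < s" "s < 1" using less unfolding s_def by (auto simp: field_simps)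
  have "area2 u (v - s *\<^sub>R v') = area2 u v - s * area2 u v'" unfolding area2_def by (simp add: algebra_simps)
  also have "\<dots> = 0" using pos less unfolding s_def by simp
  finally have "area2 u (v - s *\<^sub>R v') = 0" .
  moreover have "u \<noteq> 0" using N is_norm_0 by force
  ultimately obtain t where "v - s *\<^sub>R v' = t *\<^sub>R u" using area2_eq_0_iff by blast
  define z where "z = s *\<^sub>R v'"
  have vz: "v = z + t *\<^sub>R u" using \<open>v - s *\<^sub>R v' = t *\<^sub>R u\<close> unfolding z_def by (simp add: algebra_simps)
  have Nv: "N v = 1" "N (v - u) = 1" "N v' = 1" "N (v' - u) = 1"
    using v v' unfolding equilateral_apices_def by auto
  have Nz: "N z < 1" using s Nv(3) unfolding z_def by (simp add: is_norm_scale[OF N(1)])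
  consider "t \<le> 0" | "0 < t" "t \<le> 1" | "1 < t" by linarith
  then show False
  proof cases
    case 1
    define l where "l = t / (t - 1)"
    have l: "0 \<le> l" "l < 1" "l * (t - 1) = t"
      using 1 unfolding l_def by (auto simp: divide_nonpos_neg field_simps)
    have "(1 - l) *\<^sub>R z + l *\<^sub>R (v - u) = z + (l * (t - 1)) *\<^sub>R u"
      unfolding vz by (simp add: algebra_simps)
    then have "(1 - l) *\<^sub>R z + l *\<^sub>R (v - u) = v" unfolding l(3) vz .
    then show False using is_norm_interior_combination[OF N(1) Nz, of "v - u" l] l Nv by simp
  next
    case 2
    have "z - u = (1 - s) *\<^sub>R (- u) + s *\<^sub>R (v' - u)" unfolding z_def by (simp add: algebra_simps)
    then have "N (z - u) \<le> (1 - s) * N (- u) + s * N (v' - u)"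
      using is_norm_convex_combination[OF N(1), of s "- u" "v' - u"] s by simp
    then have zu: "N (z - u) \<le> 1" using Nv N by (simp add: is_norm_uminus)
    have "t *\<^sub>R z + (1 - t) *\<^sub>R (z - u) = v - u" unfolding vz by (simp add: algebra_simps)
    then show False using is_norm_interior_combination[OF N(1) Nz zu, of "1 - t"] 2 Nv by simp
  next
    case 3
    define l where "l = (t - 1) / t"
    have l: "0 \<le> l" "l < 1" "l * t = t - 1" using 3 unfolding l_def by (auto simp: field_simps)
    have "(1 - l) *\<^sub>R z + l *\<^sub>R v = z + (l * t) *\<^sub>R u"
      unfolding vz by (simp add: algebra_simps)
    then have "(1 - l) *\<^sub>R z + l *\<^sub>R v = v - u" unfolding l(3) vz by (simp add: algebra_simps)
    then show False using is_norm_interior_combination[OF N(1) Nz, of v l] l Nv by simp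
  qed
qed

text \<open>
  Two apices \<open>v\<close> and \<open>v'\<close> have the same height, so they and \<open>v -
  u\<close>, \<open>v' - u\<close> lie on one line parallel to \<open>u\<close>, and all four have
  norm 1. If \<open>v'\<close> is the one further in the direction of \<open>u\<close>, then
  \<open>N\<close> attains its maximum over the segment from \<open>v - u\<close> to
  \<open>v'\<close> in between, namely at \<open>v\<close>. By convexity \<open>N\<close> is
  constant on this segment, so all points between \<open>v\<close> and \<open>v'\<close> are apices
  too.
\<close>

lemma convex_equilateral_apices:
  assumes N: "is_norm N" "N u = 1"
  shows "convex (equilateral_apices N u)"
proof -
  have between: "v + r *\<^sub>R u \<in> equilateral_apices N u"
    if v: "v \<in> equilateral_apices N u" and v': "v + t *\<^sub>R u \<in> equilateral_apices N u"
      and r: "0 \<le> r" "r \<le> t" for v t r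
  proof (cases "t = 0")
    case True
    then show ?thesis using v r by simp
  next
    case False
    define w where "w = v + r *\<^sub>R u"
    define v' where "v' = v + t *\<^sub>R u"
    have Nv: "N v = 1" "N (v - u) = 1" "N v' = 1" "N (v' - u) = 1"
      using v v' unfolding equilateral_apices_def v'_def by auto
    define s where "s = r / t"
    have s: "0 \<le> s" "s \<le> 1" "s * t = r" using r False unfolding s_def by (auto simp: field_simps)
    have "(1 - s) *\<^sub>R v + s *\<^sub>R v' = v + (s * t) *\<^sub>R u"
      "(1 - s) *\<^sub>R (v - u) + s *\<^sub>R (v' - u) = v - u + (s * t) *\<^sub>R u"
      unfolding v'_def by (simp_all add: algebra_simps)
    then have comb: "(1 - s) *\<^sub>R v + s *\<^sub>R v' = w" "(1 - s) *\<^sub>R (v - u) + s *\<^sub>R (v' - u) = w - u"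
      unfolding s(3) w_def by (simp_all add: algebra_simps)
    have le: "N w \<le> 1" "N (w - u) \<le> 1"
      using is_norm_convex_combination[OF N(1) s(1,2), of v v']
        is_norm_convex_combination[OF N(1) s(1,2), of "v - u" "v' - u"] unfolding comb Nv by simp_all
    have "\<not> N w < 1"
    proof
      assume "N w < 1"
      define l where "l = r / (1 + r)"
      have l: "0 \<le> l" "l < 1" "(1 - l) * r - l = 0" using r unfolding l_def by (auto simp: field_simps)
      have "(1 - l) *\<^sub>R w + l *\<^sub>R (v - u) = v + ((1 - l) * r - l) *\<^sub>R u"
        unfolding w_def by (simp add: algebra_simps)
      then show False
        using is_norm_interior_combination[OF N(1) \<open>N w < 1\<close>, of "v - u" l] l Nv by simp
    qed
    moreover have "\<not> N (w - u) < 1"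
    proof
      assume "N (w - u) < 1"
      define l where "l = (t - r) / (t - r + 1)"
      have l: "0 \<le> l" "l < 1" "l * (t - r + 1) = t - r"
        using r unfolding l_def by (auto simp: field_simps)
      then have l': "(1 - l) * (r - 1) + l * t = t - 1" by (simp add: algebra_simps)
      have "(1 - l) *\<^sub>R (w - u) + l *\<^sub>R v' = v + ((1 - l) * (r - 1) + l * t) *\<^sub>R u"
        unfolding w_def v'_def by (simp add: algebra_simps)
      also have "\<dots> = v' - u" unfolding l' v'_def by (simp add: algebra_simps)
      finally show False
        using is_norm_interior_combination[OF N(1) \<open>N (w - u) < 1\<close>, of v' l] l Nv by simp
    qed
    moreover have "area2 u w = area2 u v" unfolding w_def area2_def by (simp add: algebra_simps)
    ultimately show ?thesis using le v unfolding equilateral_apices_def w_def[symmetric] by simp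
  qed
  show ?thesis unfolding convex_alt
  proof (intro ballI allI impI, elim conjE)
    fix v v' and s :: real
    assume vv: "v \<in> equilateral_apices N u" "v' \<in> equilateral_apices N u" and s: "0 \<le> s" "s \<le> 1"
    have "area2 u v = area2 u v'"
      using equilateral_apices_area_not_less[OF N vv] equilateral_apices_area_not_less[OF N vv(2,1)]
      by linarith
    then have "area2 u (v' - v) = 0" unfolding area2_def by (simp add: algebra_simps)
    moreover have "u \<noteq> 0" using N is_norm_0 by force
    ultimately obtain t where "v' - v = t *\<^sub>R u" using area2_eq_0_iff by blast
    then have t: "v' = v + t *\<^sub>R u" by (simp add: algebra_simps)
    show "(1 - s) *\<^sub>R v + s *\<^sub>R v' \<in> equilateral_apices N u"
    proof (cases "t \<ge> 0")
      case True
      have "v + (s * t) *\<^sub>R u \<in> equilateral_apices N u"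
      proof (rule between[of v t])
        show "v + t *\<^sub>R u \<in> equilateral_apices N u" using vv(2) unfolding t .
        show "0 \<le> s * t" "s * t \<le> t"
          using True s by (auto intro: mult_left_le_one_le)
      qed (rule vv(1))
      moreover have "(1 - s) *\<^sub>R v + s *\<^sub>R v' = v + (s * t) *\<^sub>R u" unfolding t by (simp add: algebra_simps)
      ultimately show ?thesis by simp
    next
      case False
      have "v' + ((1 - s) * (- t)) *\<^sub>R u \<in> equilateral_apices N u"
      proof (rule between[of v' "- t"])
        show "v' + (- t) *\<^sub>R u \<in> equilateral_apices N u" using vv(1) unfolding t by simp
        show "0 \<le> (1 - s) * - t" "(1 - s) * - t \<le> - t"
          using False s mult_nonneg_nonneg[of "1 - s" "- t"] mult_left_le_one_le[of "- t" "1 - s"]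
          by simp_all
      qed (rule vv(2))
      moreover have "(1 - s) *\<^sub>R v + s *\<^sub>R v' = v' + ((1 - s) * (- t)) *\<^sub>R u" unfolding t by (simp add: algebra_simps)
      ultimately show ?thesis by simp
    qed
  qed
qed

text \<open>
  Along the upper half of the unit circle, from \<open>u\<close> to \<open>- u\<close>, the distance
  from \<open>u\<close> grows from 0 to 2.
\<close>

lemma equilateral_apices_nonempty:
  assumes N: "is_norm N" "N u = 1"
  shows "equilateral_apices N u \<noteq> {}"
proof -
  have u0: "u \<noteq> 0" using N is_norm_0 by force
  define u' :: "real ^ 2" where "u' = vector [- u $ 2, u $ 1]"
  define w where "w t = cos t *\<^sub>R u + sin t *\<^sub>R u'" for t
  have area_w: "area2 u (w t) = sin t * ((u $ 1)\<^sup>2 + (u $ 2)\<^sup>2)" for t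
    unfolding w_def u'_def area2_def by (simp add: algebra_simps power2_eq_square)
  have w0: "w t \<noteq> 0" for t
  proof
    assume "w t = 0"
    then have "sin t * ((u $ 1)\<^sup>2 + (u $ 2)\<^sup>2) = 0" using area_w[of t] by (simp add: area2_def)
    moreover have "(u $ 1)\<^sup>2 + (u $ 2)\<^sup>2 \<noteq> 0" using u0 by (simp add: sum_power2_eq_zero_iff vec_eq_iff forall_2)
    ultimately have "sin t = 0" by auto
    then have "cos t \<noteq> 0" by (metis sin_zero_abs_cos_one abs_zero zero_neq_one)
    then show False using \<open>w t = 0\<close> \<open>sin t = 0\<close> u0 unfolding w_def by simp
  qed
  have Nw: "N (w t) > 0" for t using w0[of t] is_norm_eq_0[OF N(1), of "w t"] is_norm_nonneg[OF N(1), of "w t"] by linarith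
  define p where "p t = inverse (N (w t)) *\<^sub>R w t" for t
  have "continuous_on {0..pi} w" unfolding w_def by (intro continuous_intros)
  then have "continuous_on {0..pi} p" unfolding p_def using w0 Nw
    by (intro continuous_intros is_norm_compose_continuous_on[OF N(1)]) (auto simp: less_imp_neq[symmetric])
  then have cont: "continuous_on {0..pi} (\<lambda>t. N (p t - u))"
    by (intro is_norm_compose_continuous_on[OF N(1)] continuous_intros)
  have "N (p 0 - u) = 0" using N unfolding p_def w_def by (simp add: is_norm_0)
  moreover have "p pi - u = (-2) *\<^sub>R u" using N unfolding p_def w_def by (simp add: is_norm_uminus scaleR_2)
  then have "N (p pi - u) = 2" using N by (simp only: is_norm_scale)
  ultimately obtain t where t: "0 \<le> t" "t \<le> pi" "N (p t - u) = 1"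
    using IVT'[of "\<lambda>t. N (p t - u)" 0 1 pi] cont by auto
  have "N (p t) = 1" unfolding p_def using Nw[of t] by (simp add: is_norm_scale[OF N(1)])
  moreover have "area2 u (p t) = inverse (N (w t)) * area2 u (w t)"
    unfolding p_def area2_def by (simp add: algebra_simps)
  then have "area2 u (p t) \<ge> 0" using Nw[of t] area_w[of t] sin_ge_zero[OF t(1,2)] by simp
  ultimately show ?thesis using t unfolding equilateral_apices_def by blast
qed

lemma is_norm_sphere_compact_connected:
  fixes N :: "real ^ 2 \<Rightarrow> real"
  assumes "is_norm N"
  shows "compact {u. N u = 1}" "connected {u. N u = 1}"
proof -
  have Npos: "N x > 0" if "x \<noteq> 0" for x
    using that is_norm_eq_0[OF assms, of x] is_norm_nonneg[OF assms, of x] by linarith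
  have "{u. N u = 1} = (\<lambda>x. inverse (N x) *\<^sub>R x) ` sphere 0 1" (is "?S = ?f ` _")
  proof (intro equalityI subsetI)
    fix u assume u: "u \<in> ?S"
    then have "u \<noteq> 0" using is_norm_0[OF assms] by force
    then have "u = ?f (inverse (norm u) *\<^sub>R u)" using u by (simp add: is_norm_scale[OF assms])
    then show "u \<in> ?f ` sphere 0 1" using \<open>u \<noteq> 0\<close> by (intro image_eqI[of _ _ "inverse (norm u) *\<^sub>R u"]) auto
  next
    fix u assume "u \<in> ?f ` sphere 0 1"
    then obtain x where x: "u = ?f x" "norm x = 1" by auto
    then have "N x > 0" by (intro Npos) auto
    then show "u \<in> ?S" using x by (simp add: is_norm_scale[OF assms])
  qed
  moreover have "continuous_on (sphere 0 1) ?f"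
  proof (intro continuous_intros is_norm_continuous_on[OF assms] ballI)
    show "N x \<noteq> 0" if "x \<in> sphere 0 1" for x
      using that is_norm_eq_0[OF assms, of x] by auto
  qed
  ultimately show "compact ?S" "connected ?S"
    by (simp_all add: compact_continuous_image connected_continuous_image connected_sphere)
qed

text \<open>
  A continuous surjection from a compact space with connected fibres pulls connected sets back to
  connected sets.
\<close>

lemma connected_equilateral_triangles:
  assumes N: "is_norm N"
  shows "connected {(u, v). N u = 1 \<and> v \<in> equilateral_apices N u}"
proof -
  let ?S = "{u. N u = 1}" and ?G = "{(u, v). N u = 1 \<and> v \<in> equilateral_apices N u}"
  have eq: "?G = (?S \<times> ?S) \<inter> {p. N (snd p - fst p) = 1} \<inter> {p. 0 \<le> area2 (fst p) (snd p)}"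
    unfolding equilateral_apices_def by auto
  have "closed {p. N (snd p - fst p) = 1}"
    by (intro closed_Collect_eq is_norm_compose_continuous_on[OF N] continuous_intros)
  moreover have "closed {p. 0 \<le> area2 (fst p) (snd p)}"
    unfolding area2_def by (intro closed_Collect_le continuous_intros)
  ultimately have comp: "compact ?G" unfolding eq
    by (intro compact_Int_closed compact_Times is_norm_sphere_compact_connected[OF N])
  have fim: "fst ` ?G = ?S"
    using equilateral_apices_nonempty[OF N] by force
  have "connected (?G \<inter> fst -` ?S)"
  proof (rule connected_closed_monotone_preimage[where T = "?S"])
    show "continuous_on ?G fst" by (intro continuous_intros)
    then show "closedin (top_of_set ?S) (fst ` C)" if "closedin (top_of_set ?G) C" for C
      using that comp fim by (intro Abstract_Topology_2.continuous_imp_closed_map[of ?G])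
    show "connected (?G \<inter> fst -` {u})" if "u \<in> ?S" for u
    proof -
      have "?G \<inter> fst -` {u} = Pair u ` equilateral_apices N u" using that by auto
      moreover have "connected (Pair u ` equilateral_apices N u)"
        using convex_equilateral_apices[OF N] that
        by (intro connected_continuous_image continuous_intros convex_connected) auto
      ultimately show ?thesis by simp
    qed
  qed (use fim is_norm_sphere_compact_connected[OF N] in auto)
  moreover have "?G \<inter> fst -` ?S = ?G" by auto
  ultimately show ?thesis by simp
qed

lemma rhombus_tips_at_unit_distance:
  fixes N :: "real ^ 2 \<Rightarrow> real"
  assumes N: "is_norm N"
  obtains u v u' v' where "N u = 1" "N v = 1" "N (v - u) = 1"
    "N u' = 1" "N v' = 1" "N (v' - u') = 1" "N ((u + v) - (u' + v')) = 1"
proof -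
  let ?G = "{(u, v). N u = 1 \<and> v \<in> equilateral_apices N u}"
  obtain e :: "real ^ 2" where "e \<in> {u. N u = 1}"
  proof -
    have "inverse (N 1) *\<^sub>R 1 \<in> {u. N u = 1}"
      using is_norm_eq_0[OF N, of 1] by (simp add: is_norm_scale[OF N] is_norm_nonneg[OF N])
    then show ?thesis by (rule that)
  qed
  then obtain f where ef: "N e = 1" "f \<in> equilateral_apices N e"
    using equilateral_apices_nonempty[OF N] by blast
  define h where "h = (\<lambda>p :: (real^2) \<times> (real^2). N ((e + f) - (fst p + snd p)))"
  have G: "(e, f) \<in> ?G" "(- e, - f) \<in> ?G"
    using ef unfolding equilateral_apices_def area2_def
    by (auto simp: is_norm_uminus[OF N] is_norm_minus_commute[OF N])
  have "h (e, f) = 0" unfolding h_def by (simp add: is_norm_0[OF N])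
  moreover have "h (- e, - f) \<ge> 1"
  proof -
    have "h (- e, - f) = N (2 *\<^sub>R (e + f))" unfolding h_def by (simp add: scaleR_2)
    also have "\<dots> = 2 * N (e + f)" by (simp add: is_norm_scale[OF N])
    finally have "h (- e, - f) = 2 * N (e + f)" .
    moreover have "2 *\<^sub>R e = (e + f) + (e - f)" by (simp add: scaleR_2)
    then have "2 * N e \<le> N (e + f) + N (e - f)"
      using is_norm_triangle[OF N, of "e + f" "e - f"] is_norm_scale[OF N, of 2 e] by simp
    ultimately show ?thesis using ef is_norm_minus_commute[OF N, of e f]
      unfolding equilateral_apices_def by simp
  qed
  moreover have "connected (h ` ?G)"
    unfolding h_def
    by (intro connected_continuous_image connected_equilateral_triangles[OF N]
        is_norm_compose_continuous_on[OF N] continuous_intros)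
  ultimately have "1 \<in> h ` ?G"
    using connectedD_interval[of "h ` ?G" "h (e, f)" "h (- e, - f)" 1] G by fastforce
  then obtain u v where "(u, v) \<in> ?G" "h (u, v) = 1" by auto
  then show ?thesis using that[of e f u v] ef unfolding h_def equilateral_apices_def by simp
qed

theorem no_three_colouring:
  fixes N :: "real ^ 2 \<Rightarrow> real"
  assumes N: "is_norm N"
  shows "\<nexists>c. proper_colouring UNIV (unit_distance_adj N) 3 c"
proof
  assume "\<exists>c. proper_colouring UNIV (unit_distance_adj N) 3 c"
  then obtain c where c: "\<And>x. c x < 3" "\<And>x y. N (x - y) = 1 \<Longrightarrow> c x \<noteq> (c y :: nat)"
    unfolding proper_colouring_def unit_distance_adj_def by blast
  have tip: "c (u + v) = c 0" if "N u = 1" "N v = 1" "N (v - u) = 1" for u v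
  proof -
    have "c u \<noteq> c 0" "c v \<noteq> c 0" "c v \<noteq> c u" "c (u + v) \<noteq> c u" "c (u + v) \<noteq> c v"
      using that by (auto intro!: c(2))
    then show ?thesis using c(1)[of u] c(1)[of v] c(1)[of 0] c(1)[of "u + v"] by linarith
  qed
  obtain u v u' v' where "N u = 1" "N v = 1" "N (v - u) = 1"
    "N u' = 1" "N v' = 1" "N (v' - u') = 1" "N ((u + v) - (u' + v')) = 1"
    using rhombus_tips_at_unit_distance[OF N] .
  then show False using tip[of u v] tip[of u' v'] c(2)[of "u + v" "u' + v'"] by simp
qed

section \<open>Norms without a given coincidence form an open set\<close>

text \<open>
  The matrix of coefficients is a list of lists, so that it ranges over a countable type.
\<close>

definition rational_combination :: "nat \<Rightarrow> rat list list \<Rightarrow> (nat \<Rightarrow> real ^ 2) \<Rightarrow> nat \<Rightarrow> real ^ 2" where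
  "rational_combination k q v j = (\<Sum>i<k. of_rat (q ! j ! i) *\<^sub>R v i)"

text \<open>
  The unit vectors \<open>v i\<close> have \<open>2 * k\<close> real coordinates in total, while the
  second conjunct imposes \<open>2 * k + 1\<close> conditions on them. The separation keeps the set
  of bad norms closed: in the limit two of the combinations could otherwise become equal or
  opposite, and the conditions dependent.
\<close>

definition coincidence :: "nat \<Rightarrow> rat list list \<Rightarrow> nat \<Rightarrow> (real ^ 2 \<Rightarrow> real) \<Rightarrow> (nat \<Rightarrow> real ^ 2) \<Rightarrow> bool" where
  "coincidence k q n N v \<longleftrightarrow>
     (\<forall>i<k. N (v i) = 1) \<and>
     (\<forall>j<2 * k + 1. N (rational_combination k q v j) = 1) \<and>
     (\<forall>j<2 * k + 1. \<forall>j'<j.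
        1 / real (Suc n) \<le> norm (rational_combination k q v j - rational_combination k q v j') \<and>
        1 / real (Suc n) \<le> norm (rational_combination k q v j + rational_combination k q v j'))"

definition degenerate_bodies :: "nat \<Rightarrow> rat list list \<Rightarrow> nat \<Rightarrow> (real ^ 2) set set" where
  "degenerate_bodies k q n = {unit_ball N | N. is_norm N \<and> (\<exists>v. coincidence k q n N v)}"

text \<open>
  A point of \<open>unit_ball N'\<close> is close to \<open>unit_ball N\<close>, which bounds
  \<open>N x\<close> from above. For the lower bound, if \<open>N x < 1\<close>, push
  \<open>x\<close> in the normal direction of a supporting line of \<open>unit_ball N'\<close> until
  the upper estimate of its \<open>N\<close>-norm is 1. The resulting point of \<open>unit_ball
  N\<close> is at least as far from \<open>unit_ball N'\<close> as from the line.
\<close>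

lemma unit_vector_value_near_1:
  fixes N N' :: "real ^ 2 \<Rightarrow> real"
  assumes N: "is_norm N" and N': "is_norm N'" and C: "C > 0" "\<And>x. N x \<le> C * norm x"
    and x: "N' x = 1"
  shows "\<bar>N x - 1\<bar> \<le> C * hausdorff_dist (unit_ball N') (unit_ball N)"
proof -
  let ?K = "unit_ball N" and ?K' = "unit_ball N'"
  let ?d = "hausdorff_dist ?K' ?K"
  have K: "?K \<noteq> {}" "closed ?K" "bounded ?K" "?K' \<noteq> {}" "closed ?K'" "bounded ?K'"
    using bodies2D[OF unit_ball_in_bodies2[OF N]] bodies2D[OF unit_ball_in_bodies2[OF N']] by auto
  have "x \<in> ?K'" using x unfolding unit_ball_def by simp
  then have "infdist x ?K \<le> ?d" using infdist_le_hausdorff_dist[of ?K' ?K x] K by blast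
  moreover obtain y where y: "y \<in> ?K" "infdist x ?K = dist x y"
    using infdist_attains_inf[of ?K x] K by metis
  ultimately have "dist x y \<le> ?d" by simp
  have "N x \<le> N y + N (x - y)" using is_norm_triangle[OF N, of y "x - y"] by simp
  also have "\<dots> \<le> 1 + C * norm (x - y)" using y(1) C(2)[of "x - y"] unfolding unit_ball_def by simp
  also have "\<dots> \<le> 1 + C * ?d"
    using \<open>dist x y \<le> ?d\<close> C(1) by (simp add: dist_norm)
  finally have up: "N x - 1 \<le> C * ?d" by simp
  have low: "1 - N x \<le> C * ?d"
  proof (cases "N x < 1")
    case True
    obtain a where a: "a \<bullet> x = 1" "\<And>z. \<bar>a \<bullet> z\<bar> \<le> N' z"
      using is_norm_supporting_functional[OF N' x] by blast
    have a0: "a \<noteq> 0" using a(1) by auto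
    define p where "p = x + ((1 - N x) / (C * norm a)) *\<^sub>R a"
    have "N p \<le> N x + N (((1 - N x) / (C * norm a)) *\<^sub>R a)" unfolding p_def by (rule is_norm_triangle[OF N])
    also have "\<dots> \<le> N x + C * norm (((1 - N x) / (C * norm a)) *\<^sub>R a)"
      by (intro add_left_mono C(2))
    also have "\<dots> = 1" using True C(1) a0 by simp
    finally have p: "p \<in> ?K" unfolding unit_ball_def by simp
    then have "infdist p ?K' \<le> hausdorff_dist ?K ?K'" using infdist_le_hausdorff_dist[of ?K ?K' p] K by blast
    moreover obtain z where z: "z \<in> ?K'" "infdist p ?K' = dist p z"
      using infdist_attains_inf[of ?K' p] K by metis
    ultimately have "norm (p - z) \<le> ?d" by (simp add: hausdorff_dist_commute dist_norm)
    have "a \<bullet> z \<le> 1" using a(2)[of z] z(1) unfolding unit_ball_def by simp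
    moreover have "a \<bullet> p = 1 + (1 - N x) / C * norm a"
      unfolding p_def using a(1) a0 by (simp add: inner_add_right power2_norm_eq_inner[symmetric] power2_eq_square)
    ultimately have "(1 - N x) / C * norm a \<le> a \<bullet> (p - z)" by (simp add: inner_diff_right)
    also have "\<dots> \<le> norm a * norm (p - z)" by (rule norm_cauchy_schwarz)
    finally have "norm a * ((1 - N x) / C) \<le> norm a * norm (p - z)" by (simp only: mult.commute)
    then have "(1 - N x) / C \<le> norm (p - z)" using a0 mult_left_le_imp_le by (metis zero_less_norm_iff)
    then have "(1 - N x) / C \<le> ?d" using \<open>norm (p - z) \<le> ?d\<close> by simp
    then show ?thesis using C(1) by (simp add: field_simps)
  next
    case False
    then show ?thesis using C(1) hausdorff_dist_nonneg[of ?K' ?K] mult_nonneg_nonneg[of C ?d] by linarith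
  qed
  show ?thesis using up low by linarith
qed

text \<open>
  The function \<open>\<phi>\<close> measures by how much a family of vectors misses being a
  coincidence. It is continuous and positive on a compact set of families, so bounded away from 0
  there, while a coincidence for a nearby norm has a small value of \<open>\<phi>\<close>.
\<close>

lemma no_coincidence_stable:
  assumes N: "is_norm N" and none: "\<nexists>v. coincidence k q n N v"
  obtains e where "e > 0"
    "\<And>N'. is_norm N' \<Longrightarrow> hausdorff_dist (unit_ball N') (unit_ball N) < e \<Longrightarrow> \<nexists>v. coincidence k q n N' v"
proof -
  obtain C where C: "C > 0" "\<And>x. N x \<le> C * norm x" using is_norm_le_norm[OF N] by metis
  obtain c where c: "c > 0" "\<And>x. c * norm x \<le> N x" using is_norm_ge_norm[OF N] by metis
  define \<delta> where "\<delta> = 1 / real (Suc n)"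
  let ?u = "rational_combination k q"
  define \<phi> where "\<phi> v = (\<Sum>i<k. \<bar>N (v i) - 1\<bar>) + (\<Sum>j<2 * k + 1. \<bar>N (?u v j) - 1\<bar>)
    + (\<Sum>j<2 * k + 1. \<Sum>j'<j. max 0 (\<delta> - norm (?u v j - ?u v j')) + max 0 (\<delta> - norm (?u v j + ?u v j')))"
    for v :: "nat \<Rightarrow> real ^ 2"
  have pos: "\<phi> v > 0" for v
  proof (rule ccontr)
    assume "\<not> \<phi> v > 0"
    moreover have "(\<Sum>i<k. \<bar>N (v i) - 1\<bar>) \<ge> 0" "(\<Sum>j<2 * k + 1. \<bar>N (?u v j) - 1\<bar>) \<ge> 0"
      "(\<Sum>j<2 * k + 1. \<Sum>j'<j. max 0 (\<delta> - norm (?u v j - ?u v j')) + max 0 (\<delta> - norm (?u v j + ?u v j'))) \<ge> 0"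
      by (intro sum_nonneg; simp)+
    ultimately have z: "(\<Sum>i<k. \<bar>N (v i) - 1\<bar>) = 0" "(\<Sum>j<2 * k + 1. \<bar>N (?u v j) - 1\<bar>) = 0"
      "(\<Sum>j<2 * k + 1. \<Sum>j'<j. max 0 (\<delta> - norm (?u v j - ?u v j')) + max 0 (\<delta> - norm (?u v j + ?u v j'))) = 0"
      unfolding \<phi>_def by linarith+
    have 1: "\<forall>i<k. N (v i) = 1"
      using z(1) by (subst (asm) sum_nonneg_eq_0_iff) auto
    have 2: "\<forall>j<2 * k + 1. N (?u v j) = 1"
      using z(2) by (subst (asm) sum_nonneg_eq_0_iff) auto
    have 3: "\<delta> \<le> norm (?u v j - ?u v j') \<and> \<delta> \<le> norm (?u v j + ?u v j')"
      if "j < 2 * k + 1" "j' < j" for j j'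
    proof -
      have "\<forall>j\<in>{..<2 * k + 1}. (\<Sum>j'<j. max 0 (\<delta> - norm (?u v j - ?u v j')) + max 0 (\<delta> - norm (?u v j + ?u v j'))) = 0"
        using z(3) by (subst (asm) sum_nonneg_eq_0_iff) (auto intro!: sum_nonneg)
      then have "(\<Sum>j'<j. max 0 (\<delta> - norm (?u v j - ?u v j')) + max 0 (\<delta> - norm (?u v j + ?u v j'))) = 0"
        using that by simp
      then have "\<forall>j'\<in>{..<j}. max 0 (\<delta> - norm (?u v j - ?u v j')) + max 0 (\<delta> - norm (?u v j + ?u v j')) = 0"
        by (subst (asm) sum_nonneg_eq_0_iff) auto
      then have "max 0 (\<delta> - norm (?u v j - ?u v j')) + max 0 (\<delta> - norm (?u v j + ?u v j')) = 0"
        using that by simp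
      then show ?thesis by linarith
    qed
    have "coincidence k q n N v" unfolding coincidence_def \<delta>_def[symmetric] using 1 2 3 by blast
    then show False using none by blast
  qed
  define B where "B = PiE (UNIV :: nat set) (\<lambda>_. cball (0 :: real ^ 2) (2 / c))"
  have "compactin (product_topology (\<lambda>i::nat. euclidean :: (real^2) topology) UNIV) B"
    unfolding B_def compactin_PiE by simp
  then have "compact B"
    using compactin_euclidean_iff[of B] by (simp add: euclidean_product_topology)
  moreover have "(\<lambda>_. 0) \<in> B" unfolding B_def using c by (auto simp: PiE_UNIV_domain)
  then have "B \<noteq> {}" by blast
  moreover have "continuous_on B \<phi>"
  proof -
    have coord: "continuous_on B (\<lambda>v. v i)" for i :: nat
      by (rule continuous_on_subset[OF continuous_on_product_coordinates]) simp
    have "continuous_on B (\<lambda>v. ?u v j)" for j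
      unfolding rational_combination_def by (intro continuous_intros coord)
    then show ?thesis unfolding \<phi>_def
      by (intro continuous_intros is_norm_compose_continuous_on[OF N] coord)
  qed
  ultimately obtain v0 where v0: "v0 \<in> B" "\<And>v. v \<in> B \<Longrightarrow> \<phi> v0 \<le> \<phi> v"
    using continuous_attains_inf by metis
  define e where "e = min (1 / C) (\<phi> v0 / (C * real (3 * k + 2)))"
  have e: "e > 0" "C * e \<le> 1" "C * e * real (3 * k + 1) < \<phi> v0"
  proof -
    show "e > 0" unfolding e_def using C(1) pos[of v0] by simp
    have "C * e \<le> C * (1 / C)" unfolding e_def using C(1) by (intro mult_left_mono) auto
    then show "C * e \<le> 1" using C(1) by simp
    have "C * e * real (3 * k + 1) < C * e * real (3 * k + 2)" using C(1) \<open>e > 0\<close> by simp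
    also have "\<dots> \<le> C * (\<phi> v0 / (C * real (3 * k + 2))) * real (3 * k + 2)"
      unfolding e_def using C(1) by (intro mult_left_mono mult_right_mono) auto
    also have "\<dots> = \<phi> v0" using C(1) by (simp del: of_nat_add of_nat_mult)
    finally show "C * e * real (3 * k + 1) < \<phi> v0" .
  qed
  show ?thesis
  proof (rule that[OF e(1)])
    fix N' assume N': "is_norm N'" and d: "hausdorff_dist (unit_ball N') (unit_ball N) < e"
    have near: "\<bar>N x - 1\<bar> \<le> C * e" if "N' x = 1" for x
      using unit_vector_value_near_1[OF N N' C that] mult_left_mono[of _ e C] C(1) d
      by (meson less_eq_real_def order_trans)
    show "\<nexists>v. coincidence k q n N' v"
    proof
      assume "\<exists>v. coincidence k q n N' v"
      then obtain v where v: "coincidence k q n N' v" by blast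
      (* Only the first k vectors matter; the others are set to 0 to land in the compact set B. *)
      define w where "w i = (if i < k then v i else 0)" for i
      have uw: "?u w = ?u v" unfolding rational_combination_def w_def by (intro ext sum.cong) auto
      have "w \<in> B" unfolding B_def PiE_UNIV_domain
      proof (rule Pi_I)
        fix i
        show "w i \<in> cball 0 (2 / c)"
        proof (cases "i < k")
          case True
          then have "N (v i) \<le> 2" using near[of "v i"] v e(2) unfolding coincidence_def by force
          then have "c * norm (v i) \<le> 2" using c(2)[of "v i"] by linarith
          then show ?thesis using True c(1) unfolding w_def by (simp add: field_simps)
        qed (use c in \<open>simp add: w_def\<close>)
      qed
      moreover have "\<phi> w \<le> C * e * real (3 * k + 1)"
      proof -
        have "(\<Sum>i<k. \<bar>N (w i) - 1\<bar>) \<le> (\<Sum>i<k. C * e)"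
          using v unfolding w_def coincidence_def by (intro sum_mono) (auto intro: near)
        moreover have "(\<Sum>j<2 * k + 1. \<bar>N (?u w j) - 1\<bar>) \<le> (\<Sum>j<2 * k + 1. C * e)"
          using v unfolding uw coincidence_def by (intro sum_mono near) auto
        moreover have "(\<Sum>j<2 * k + 1. \<Sum>j'<j. max 0 (\<delta> - norm (?u w j - ?u w j')) + max 0 (\<delta> - norm (?u w j + ?u w j'))) = 0"
          using v unfolding uw coincidence_def \<delta>_def[symmetric]
          by (intro sum.neutral ballI) simp
        ultimately show ?thesis unfolding \<phi>_def by (simp add: algebra_simps)
      qed
      ultimately show False using v0(2)[of w] e(3) by linarith
    qed
  qed
qed

text \<open>
  Each ball shrunk by the factor \<open>1 + t\<close> lies in the other one.
\<close>

lemma hausdorff_dist_unit_balls_le: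
  fixes N N' :: "real ^ 2 \<Rightarrow> real"
  assumes N: "is_norm N" and N': "is_norm N'" and R: "\<And>x. norm x \<le> R * N x" and "0 \<le> t"
    and le: "\<And>x. N x \<le> (1 + t) * N' x" "\<And>x. N' x \<le> (1 + t) * N x"
  shows "hausdorff_dist (unit_ball N) (unit_ball N') \<le> t * R"
proof -
  have K: "unit_ball N \<noteq> {}" "bounded (unit_ball N)" "unit_ball N' \<noteq> {}" "bounded (unit_ball N')"
    using bodies2D[OF unit_ball_in_bodies2[OF N]] bodies2D[OF unit_ball_in_bodies2[OF N']] by auto
  have R0: "R \<ge> 0"
  proof -
    have "0 < norm (1 :: real^2)" by simp
    then have "0 < R * N 1" using R[of 1] by linarith
    then show ?thesis using is_norm_nonneg[OF N, of 1] by (simp add: zero_less_mult_iff)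
  qed
  define s where "s = inverse (1 + t)"
  have s: "0 < s" "s \<le> 1" "(1 + t) * s = 1" using \<open>0 \<le> t\<close> unfolding s_def by (auto simp: field_simps)
  have dist: "dist x (s *\<^sub>R x) = t * norm (s *\<^sub>R x)" for x :: "real ^ 2"
  proof -
    have "x - s *\<^sub>R x = ((1 + t) * s - s) *\<^sub>R x" unfolding s(3) by (simp add: algebra_simps)
    also have "\<dots> = t *\<^sub>R s *\<^sub>R x" by (simp add: algebra_simps)
    finally show ?thesis using \<open>0 \<le> t\<close> s by (simp add: dist_norm)
  qed
  show ?thesis
  proof (rule hausdorff_dist_le[OF K(1,3,2,4)])
    fix x assume x: "x \<in> unit_ball N"
    have "N' (s *\<^sub>R x) \<le> s * ((1 + t) * N x)" using le(2)[of x] s by (simp add: is_norm_scale[OF N'])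
    also have "\<dots> = N x" using s(3) by (metis mult.assoc mult.commute mult_1)
    finally have "s *\<^sub>R x \<in> unit_ball N'" using x unfolding unit_ball_def by simp
    then have "infdist x (unit_ball N') \<le> t * norm (s *\<^sub>R x)" using infdist_le dist by metis
    also have "\<dots> \<le> t * (R * N x)"
    proof (intro mult_left_mono \<open>0 \<le> t\<close>)
      have "norm (s *\<^sub>R x) \<le> norm x" using s by (simp add: mult_left_le_one_le)
      then show "norm (s *\<^sub>R x) \<le> R * N x" using R[of x] by linarith
    qed
    also have "\<dots> \<le> t * (R * 1)" using x R0 \<open>0 \<le> t\<close> unfolding unit_ball_def by (intro mult_left_mono) auto
    finally show "infdist x (unit_ball N') \<le> t * R" by simp
  next
    fix x assume x: "x \<in> unit_ball N'"
    have "N (s *\<^sub>R x) \<le> s * ((1 + t) * N' x)" using le(1)[of x] s by (simp add: is_norm_scale[OF N])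
    also have "\<dots> = N' x" using s(3) by (metis mult.assoc mult.commute mult_1)
    finally have sx: "N (s *\<^sub>R x) \<le> 1" using x unfolding unit_ball_def by simp
    then have "infdist x (unit_ball N) \<le> t * norm (s *\<^sub>R x)"
      using infdist_le dist unfolding unit_ball_def by (metis mem_Collect_eq)
    also have "\<dots> \<le> t * (R * N (s *\<^sub>R x))" using R \<open>0 \<le> t\<close> by (intro mult_left_mono)
    also have "\<dots> \<le> t * (R * 1)" using sx R0 \<open>0 \<le> t\<close> by (intro mult_left_mono) auto
    finally show "infdist x (unit_ball N) \<le> t * R" by simp
  qed
qed

section \<open>Norms without coincidences are 4-colourable\<close>

text \<open>
  Let \<open>H\<close> be a half of the unit circle, containing exactly one of each two opposite
  vectors. A set \<open>W \<subseteq> H\<close> with more than \<open>2 * k\<close> elements and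
  rational dimension \<open>k\<close> gives a coincidence: write \<open>2 * k + 1\<close> elements
  of \<open>W\<close> in terms of a rational basis \<open>v\<close> contained in \<open>W\<close>.
\<close>

lemma four_colouring_if_no_coincidence:
  assumes N: "is_norm N" and none: "\<And>k q n v. \<not> coincidence k q n N v"
  shows "\<exists>c. proper_colouring UNIV (unit_distance_adj N) 4 c"
proof (rule four_colouring[OF N])
  define H where "H = {u :: real ^ 2. N u = 1 \<and> (0 < u $ 1 \<or> u $ 1 = 0 \<and> 0 < u $ 2)}"
  have Hneg: "- u \<notin> H" if "u \<in> H" for u using that unfolding H_def by auto
  show "u \<in> H \<or> - u \<in> H" if "N u = 1" for u
  proof -
    have "u \<noteq> 0" using that is_norm_0[OF N] by force
    then have "u $ 1 \<noteq> 0 \<or> u $ 2 \<noteq> 0" by (auto simp: vec_eq_iff forall_2)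
    then show ?thesis using that unfolding H_def by (auto simp: is_norm_uminus[OF N])
  qed
  show "card W \<le> 2 * rational.dim W" if W: "W \<subseteq> H" "finite W" for W
  proof (rule ccontr)
    define k where "k = rational.dim W"
    assume "\<not> card W \<le> 2 * rational.dim W"
    then have "2 * k + 1 \<le> card W" unfolding k_def by simp
    then obtain W' where W': "W' \<subseteq> W" "card W' = 2 * k + 1" "finite W'"
      using obtain_subset_with_card_n by metis
    obtain B where B: "B \<subseteq> W" "W \<subseteq> rational.span B" "card B = k"
      using rational.basis_exists[of W] unfolding k_def by metis
    have "finite B" using B(1) W(2) finite_subset by blast
    obtain v where v: "bij_betw v {..<k} B"
      using ex_bij_betw_nat_finite[OF \<open>finite B\<close>] B(3) atLeast0LessThan by metis
    obtain w where w: "bij_betw w {..<2 * k + 1} W'"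
      using ex_bij_betw_nat_finite[OF W'(3)] W'(2) atLeast0LessThan by metis
    have wW: "w j \<in> W" if "j < 2 * k + 1" for j
      using bij_betwE[OF w] that W'(1) by blast
    have "\<exists>r. x = (\<Sum>b\<in>B. of_rat (r b) *\<^sub>R b)" if "x \<in> W" for x
      using that B(2) rational.span_finite[OF \<open>finite B\<close>] by blast
    then obtain r where r: "\<And>x. x \<in> W \<Longrightarrow> x = (\<Sum>b\<in>B. of_rat (r x b) *\<^sub>R b)" by metis
    define q where "q = map (\<lambda>j. map (\<lambda>i. r (w j) (v i)) [0..<k]) [0..<2 * k + 1]"
    have q_nth: "q ! j ! i = r (w j) (v i)" if "j < 2 * k + 1" "i < k" for i j
      using that unfolding q_def by (simp del: upt_Suc)
    have comb: "rational_combination k q v j = w j" if "j < 2 * k + 1" for j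
    proof -
      have "rational_combination k q v j = (\<Sum>i<k. of_rat (r (w j) (v i)) *\<^sub>R v i)"
        unfolding rational_combination_def using that by (intro sum.cong) (auto simp: q_nth)
      also have "\<dots> = (\<Sum>b\<in>B. of_rat (r (w j) b) *\<^sub>R b)"
        by (rule sum.reindex_bij_betw[OF v])
      also have "\<dots> = w j" using r[OF wW[OF that]] by simp
      finally show ?thesis .
    qed
    define D where "D = (\<lambda>p. min (norm (w (fst p) - w (snd p))) (norm (w (fst p) + w (snd p)))) `
      {p \<in> {..<2 * k + 1} \<times> {..<2 * k + 1}. snd p < fst p}"
    have "finite D" unfolding D_def
      by (rule finite_imageI, rule finite_subset[of _ "{..<2 * k + 1} \<times> {..<2 * k + 1}"]) auto
    have "d > 0" if d: "d \<in> D" for d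
    proof -
      obtain p where p: "d = min (norm (w (fst p) - w (snd p))) (norm (w (fst p) + w (snd p)))"
        "fst p < 2 * k + 1" "snd p < fst p"
        using d unfolding D_def by auto
      define j j' where "j = fst p" and "j' = snd p"
      then have j: "d = min (norm (w j - w j')) (norm (w j + w j'))" "j < 2 * k + 1" "j' < j"
        using p by simp_all
      have "w j \<noteq> w j'"
        using inj_on_contraD[OF bij_betw_imp_inj_on[OF w], of j j'] j(2,3) by simp
      moreover have "w j + w j' \<noteq> 0"
      proof
        assume "w j + w j' = 0"
        then have "w j = - w j'" by (simp add: eq_neg_iff_add_eq_0)
        moreover have "w j \<in> H" "w j' \<in> H" using wW j W(1) by auto
        ultimately show False using Hneg by metis
      qed
      ultimately show ?thesis unfolding j(1) by simp
    qed
    then have "0 < Min (insert 1 D)" using \<open>finite D\<close> by simp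
    then obtain n where n: "inverse (real (Suc n)) < Min (insert 1 D)"
      using reals_Archimedean by blast
    have "coincidence k q n N v" unfolding coincidence_def
    proof (intro conjI allI impI)
      show "N (v i) = 1" if "i < k" for i
        using bij_betwE[OF v] that B(1) W(1) unfolding H_def by blast
      show "N (rational_combination k q v j) = 1" if "j < 2 * k + 1" for j
        using wW[OF that] W(1) unfolding comb[OF that] H_def by blast
      fix j j' assume j: "j < 2 * k + 1" "j' < j"
      then have "min (norm (w j - w j')) (norm (w j + w j')) \<in> D"
        unfolding D_def by (intro image_eqI[of _ _ "(j, j')"]) auto
      then have "Min (insert 1 D) \<le> min (norm (w j - w j')) (norm (w j + w j'))"
        using \<open>finite D\<close> by (intro Min_le) auto
      then have *: "1 / real (Suc n) \<le> norm (w j - w j')" "1 / real (Suc n) \<le> norm (w j + w j')"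
        using n by (simp_all add: inverse_eq_divide)
      have "j' < 2 * k + 1" using j by simp
      then show "1 / real (Suc n) \<le> norm (rational_combination k q v j - rational_combination k q v j')"
        "1 / real (Suc n) \<le> norm (rational_combination k q v j + rational_combination k q v j')"
        unfolding comb[OF j(1)] comb[OF \<open>j' < 2 * k + 1\<close>] using * by simp_all
    qed
    then show False using none by blast
  qed
qed

section \<open>Generic polygonal norms\<close>

lemma homogeneous_system_nontrivial_solution:
  fixes M :: "'e \<Rightarrow> 'j \<Rightarrow> 'a::field"
  assumes "finite E" "finite J" "card E < card J"
  shows "\<exists>l. (\<exists>j\<in>J. l j \<noteq> 0) \<and> (\<forall>e\<in>E. (\<Sum>j\<in>J. l j * M e j) = 0)"
  using assms
proof (induction E arbitrary: J M rule: finite_induct)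
  case empty
  then obtain j where "j \<in> J" by fastforce
  then show ?case by (intro exI[of _ "\<lambda>_. 1"]) auto
next
  case (insert e E)
  show ?case
  proof (cases "\<forall>j\<in>J. M e j = 0")
    case True
    have "card E < card J" using insert.prems insert.hyps by simp
    from insert.IH[OF insert.prems(1) this, of M] obtain l where
      "\<exists>j\<in>J. l j \<noteq> 0" "\<forall>e\<in>E. (\<Sum>j\<in>J. l j * M e j) = 0" by blast
    then show ?thesis using True by (intro exI[of _ l]) simp
  next
    case False
    then obtain p where p: "p \<in> J" "M e p \<noteq> 0" by blast
    define J' where "J' = J - {p}"
    define M' where "M' e' j = M e' j - M e' p * M e j / M e p" for e' j
    have "finite J'" "card E < card J'"
      using insert.prems insert.hyps p unfolding J'_def by auto
    from insert.IH[OF this, of M'] obtain l where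
      l: "\<exists>j\<in>J'. l j \<noteq> 0" "\<forall>e'\<in>E. (\<Sum>j\<in>J'. l j * M' e' j) = 0" by blast
    define l' where "l' j = (if j = p then - (\<Sum>j\<in>J'. l j * M e j) / M e p else l j)" for j
    have split: "(\<Sum>j\<in>J. l' j * M e' j) = - (\<Sum>j\<in>J'. l j * M e j) / M e p * M e' p + (\<Sum>j\<in>J'. l j * M e' j)" for e'
    proof -
      have "(\<Sum>j\<in>J. l' j * M e' j) = l' p * M e' p + (\<Sum>j\<in>J'. l' j * M e' j)"
        unfolding J'_def using p(1) insert.prems(1) by (rule_tac sum.remove) auto
      also have "(\<Sum>j\<in>J'. l' j * M e' j) = (\<Sum>j\<in>J'. l j * M e' j)"
        by (intro sum.cong) (auto simp: l'_def J'_def)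
      finally show ?thesis by (simp add: l'_def)
    qed
    have "(\<Sum>j\<in>J. l' j * M e j) = 0" unfolding split using p(2) by simp
    moreover have "(\<Sum>j\<in>J. l' j * M e' j) = 0" if "e' \<in> E" for e'
    proof -
      have "(\<Sum>j\<in>J'. l j * M' e' j) = (\<Sum>j\<in>J'. l j * M e' j) - (\<Sum>j\<in>J'. l j * M e j) / M e p * M e' p"
        unfolding M'_def by (simp add: sum_subtractf sum_distrib_left sum_distrib_right sum_divide_distrib algebra_simps)
      then show ?thesis unfolding split using l(2) that by simp
    qed
    moreover have "\<exists>j\<in>J. l' j \<noteq> 0" using l(1) unfolding l'_def J'_def by auto
    ultimately show ?thesis by (intro exI[of _ l']) auto
  qed
qed

text \<open>
  On the curve \<open>b a = 1 + s * t ^ Suc a\<close> each of the finitely many linear forms is a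
  nonzero polynomial in \<open>t\<close>, so all but finitely many \<open>t\<close> between 0 and 1
  are suitable.
\<close>

lemma generic_weights:
  fixes F :: "(nat \<Rightarrow> real) set"
  assumes "finite F" "\<And>f. f \<in> F \<Longrightarrow> \<exists>a<m. f a \<noteq> 0" "s > 0"
  shows "\<exists>b. (\<forall>a. 1 \<le> b a \<and> b a \<le> 1 + s) \<and> (\<forall>f\<in>F. (\<Sum>a<m. f a * b a) \<noteq> (0::real))"
proof -
  define Z where "Z f = {t::real. (\<Sum>a<m. f a * (1 + s * t ^ Suc a)) = 0}" for f :: "nat \<Rightarrow> real"
  have "finite (Z f)" if f: "f \<in> F" for f
  proof -
    define c where "c i = (case i of 0 \<Rightarrow> \<Sum>a<m. f a | Suc a \<Rightarrow> s * f a)" for i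
    have "(\<Sum>i\<le>m. c i * t ^ i) = (\<Sum>a<m. f a * (1 + s * t ^ Suc a))" for t
      unfolding lessThan_Suc_atMost[symmetric] sum.lessThan_Suc_shift c_def
      by (simp add: sum.distrib algebra_simps)
    moreover obtain a where "a < m" "f a \<noteq> 0" using assms(2)[OF f] by blast
    then have "\<exists>i\<le>m. c i \<noteq> 0" using assms(3) by (intro exI[of _ "Suc a"]) (simp add: c_def)
    then have "finite {t. (\<Sum>i\<le>m. c i * t ^ i) = 0}" using polyfun_finite_roots by blast
    ultimately show ?thesis unfolding Z_def by simp
  qed
  then have "finite (\<Union>f\<in>F. Z f)" using assms(1) by blast
  then have "{0<..<1} - (\<Union>f\<in>F. Z f) \<noteq> {}"
    by (intro infinite_imp_nonempty Diff_infinite_finite) simp_all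
  then obtain t where "t \<in> {0<..<1} - (\<Union>f\<in>F. Z f)" by (meson ex_in_conv)
  then have t: "0 < t" "t < 1" "\<And>f. f \<in> F \<Longrightarrow> t \<notin> Z f" by auto
  show ?thesis
  proof (intro exI[of _ "\<lambda>a. 1 + s * t ^ Suc a"] conjI allI ballI)
    show "1 \<le> 1 + s * t ^ Suc a" for a using assms(3) t(1) by simp
    show "1 + s * t ^ Suc a \<le> 1 + s" for a
      using mult_left_mono[OF power_le_one[of t "Suc a"], of s] assms(3) t(1,2) by (simp del: power_Suc)
    show "(\<Sum>a<m. f a * (1 + s * t ^ Suc a)) \<noteq> 0" if "f \<in> F" for f using t(3)[OF that] unfolding Z_def by simp
  qed
qed

text \<open>
  Supporting functionals at the points of a finite net of the unit sphere nearly determine the norm.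
\<close>

lemma finitely_many_supporting_functionals:
  fixes N :: "'a::euclidean_space \<Rightarrow> real"
  assumes N: "is_norm N" and "s > 0"
  shows "\<exists>m Y. m > 0 \<and> (\<forall>a x. \<bar>Y a \<bullet> x\<bar> \<le> N x) \<and>
    (\<forall>x. \<exists>a<m. N x \<le> (1 + s) * \<bar>Y (a::nat) \<bullet> x\<bar>)"
proof -
  define \<rho> where "\<rho> = s / (1 + s)"
  have \<rho>: "\<rho> > 0" "(1 + s) * (1 - \<rho>) = 1" using assms(2) unfolding \<rho>_def by (auto simp: field_simps)
  let ?S = "{x. N x = 1}"
  obtain c where c: "c > 0" "\<And>x. c * norm x \<le> N x" using is_norm_ge_norm[OF N] by metis
  have "closed ?S" by (intro closed_Collect_eq is_norm_continuous_on[OF N] continuous_on_const)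
  moreover have "bounded ?S" 
  proof (rule boundedI[of _ "1 / c"])
    show "norm x \<le> 1 / c" if "x \<in> ?S" for x using c(2)[of x] c(1) that by (simp add: field_simps)
  qed
  ultimately have "compact ?S" using compact_eq_bounded_closed by blast
  moreover have "open {x. N (x - p) < \<rho>}" for p
    by (intro open_Collect_less is_norm_compose_continuous_on[OF N] continuous_intros)
  moreover have "?S \<subseteq> (\<Union>p\<in>?S. {x. N (x - p) < \<rho>})" using \<rho>(1) is_norm_0[OF N] by auto
  ultimately obtain P where P: "P \<subseteq> ?S" "finite P" "?S \<subseteq> (\<Union>p\<in>P. {x. N (x - p) < \<rho>})"
    by (rule compactE_image)
  have ne: "inverse (N x) *\<^sub>R x \<in> ?S" if "x \<noteq> 0" for x
    using that is_norm_eq_0[OF N, of x] by (simp add: is_norm_scale[OF N] is_norm_nonneg[OF N])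
  obtain e :: 'a where "e \<noteq> 0" using nonzero_Basis nonempty_Basis by blast
  then have "P \<noteq> {}" using ne[of e] P(3) by blast
  obtain p where p: "bij_betw p {..<card P} P"
    using ex_bij_betw_nat_finite[OF P(2)] atLeast0LessThan by metis
  have "\<exists>y. (a < card P \<longrightarrow> y \<bullet> p a = 1) \<and> (\<forall>x. \<bar>y \<bullet> x\<bar> \<le> N x)" for a
  proof (cases "a < card P")
    case True
    then have "N (p a) = 1" using bij_betwE[OF p] P(1) by blast
    then show ?thesis using is_norm_supporting_functional[OF N] by metis
  next
    case False
    then show ?thesis by (intro exI[of _ 0]) (simp add: is_norm_nonneg[OF N])
  qed
  then obtain Y where Y: "\<And>a. a < card P \<Longrightarrow> Y a \<bullet> p a = 1" "\<And>a x. \<bar>Y a \<bullet> x\<bar> \<le> N x" by metis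
  show ?thesis
  proof (rule exI[of _ "card P"], rule exI[of _ Y], intro conjI allI)
    show "card P > 0" using P(2) \<open>P \<noteq> {}\<close> by (simp add: card_gt_0_iff)
    show "\<bar>Y a \<bullet> x\<bar> \<le> N x" for a x by (rule Y(2))
    show "\<exists>a<card P. N x \<le> (1 + s) * \<bar>Y a \<bullet> x\<bar>" for x
    proof (cases "x = 0")
      case True
      then show ?thesis using \<open>card P > 0\<close> by (auto simp: is_norm_0[OF N])
    next
      case False
      define x' where "x' = inverse (N x) *\<^sub>R x"
      have Nx: "N x > 0" using False is_norm_eq_0[OF N, of x] is_norm_nonneg[OF N, of x] by linarith
      obtain r where r: "r \<in> P" "N (x' - r) < \<rho>" using P(3) ne[OF False] unfolding x'_def by blast
      then obtain a where a: "a < card P" "r = p a"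
        using p unfolding bij_betw_def by (metis imageE lessThan_iff)
      have "1 - Y a \<bullet> x' \<le> \<rho>"
        using Y(1)[OF a(1)] Y(2)[of a "x' - r"] r(2) a(2) by (simp add: inner_diff_right)
      then have "(1 + s) * (1 - \<rho>) \<le> (1 + s) * \<bar>Y a \<bullet> x'\<bar>" using assms(2) by (intro mult_left_mono) auto
      then have "N x * 1 \<le> N x * ((1 + s) * \<bar>Y a \<bullet> x'\<bar>)" unfolding \<rho>(2) using Nx by (intro mult_left_mono) auto
      also have "\<dots> = (1 + s) * \<bar>Y a \<bullet> x\<bar>" unfolding x'_def using Nx by (simp add: abs_mult field_simps)
      finally show ?thesis using a(1) by auto
    qed
  qed
qed

text \<open>
  For \<open>m > 0\<close> and positive \<open>b\<close>, the gauge of the intersection of the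
  strips \<open>\<bar>Y a \<bullet> x\<bar> \<le> b a\<close>.
\<close>

definition polygonal_norm :: "nat \<Rightarrow> (nat \<Rightarrow> 'a::real_inner) \<Rightarrow> (nat \<Rightarrow> real) \<Rightarrow> 'a \<Rightarrow> real" where
  "polygonal_norm m Y b x = Max ((\<lambda>a. \<bar>Y a \<bullet> x\<bar> / b a) ` {..<m})"

lemma is_norm_polygonal:
  fixes N :: "'a::euclidean_space \<Rightarrow> real" and Y :: "nat \<Rightarrow> 'a"
  assumes N: "is_norm N" and "m > 0" "s > 0"
    and le: "\<And>a x. \<bar>Y a \<bullet> x\<bar> \<le> N x" and ge: "\<And>x. \<exists>a<m. N x \<le> (1 + s) * \<bar>Y a \<bullet> x\<bar>"
    and b: "\<And>a. 1 \<le> b a" "\<And>a. b a \<le> 1 + s"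
  defines "N' \<equiv> polygonal_norm m Y b"
  shows "is_norm N'" "\<exists>a<m. \<bar>Y a \<bullet> x\<bar> = b a * N' x" "N' x \<le> N x" "N x \<le> (1 + s)\<^sup>2 * N' x"
proof -
  have b0: "b a > 0" for a using b(1)[of a] by linarith
  have fin: "finite ((\<lambda>a. \<bar>Y a \<bullet> x\<bar> / b a) ` {..<m})" "(\<lambda>a. \<bar>Y a \<bullet> x\<bar> / b a) ` {..<m} \<noteq> {}" for x
    using assms(2) by auto
  have upper: "\<bar>Y a \<bullet> x\<bar> / b a \<le> N' x" if "a < m" for a x
    unfolding N'_def polygonal_norm_def using fin that by (intro Max_ge) auto
  have attained: "\<exists>a<m. N' x = \<bar>Y a \<bullet> x\<bar> / b a" for x
    using Max_in[OF fin[of x]] unfolding N'_def polygonal_norm_def by auto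
  show att: "\<exists>a<m. \<bar>Y a \<bullet> x\<bar> = b a * N' x" for x
    using attained[of x] b0 by (metis less_numeral_extra(3) nonzero_mult_div_cancel_left times_divide_eq_right)
  show N'_le: "N' x \<le> N x" for x
  proof -
    obtain a where "N' x = \<bar>Y a \<bullet> x\<bar> / b a" using attained by blast
    also have "\<dots> \<le> \<bar>Y a \<bullet> x\<bar> / 1" using b(1)[of a] by (intro divide_left_mono) auto
    finally show ?thesis using le[of a x] by simp
  qed
  show le_N': "N x \<le> (1 + s)\<^sup>2 * N' x" for x
  proof -
    obtain a where a: "a < m" "N x \<le> (1 + s) * \<bar>Y a \<bullet> x\<bar>" using ge by blast
    have "\<bar>Y a \<bullet> x\<bar> \<le> b a * N' x" using upper[OF a(1), of x] b0[of a] by (simp add: field_simps)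
    also have "\<dots> \<le> (1 + s) * N' x"
    proof (rule mult_right_mono[OF b(2)])
      have "0 \<le> \<bar>Y a \<bullet> x\<bar> / b a" using b0[of a] by simp
      then show "0 \<le> N' x" using upper[OF a(1), of x] by linarith
    qed
    finally have "(1 + s) * \<bar>Y a \<bullet> x\<bar> \<le> (1 + s) * ((1 + s) * N' x)" using \<open>s > 0\<close> by (intro mult_left_mono) auto
    then show ?thesis using a(2) by (simp add: power2_eq_square)
  qed
  have nonneg: "0 \<le> N' x" for x
  proof -
    obtain a where "N' x = \<bar>Y a \<bullet> x\<bar> / b a" using attained by blast
    then show ?thesis using b0[of a] by simp
  qed
  show "is_norm N'" unfolding is_norm_def
  proof (intro conjI allI)
    show "0 \<le> N' x" for x by (rule nonneg)
    show "N' x = 0 \<longleftrightarrow> x = 0" for x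
    proof
      assume "N' x = 0"
      then show "x = 0" using le_N'[of x] is_norm_nonneg[OF N, of x] is_norm_eq_0[OF N, of x] by simp
    next
      assume "x = 0"
      then show "N' x = 0" using attained[of x] by auto
    qed
    show "N' (r *\<^sub>R x) = \<bar>r\<bar> * N' x" for r x
    proof (rule antisym)
      obtain a where a: "a < m" "N' (r *\<^sub>R x) = \<bar>Y a \<bullet> (r *\<^sub>R x)\<bar> / b a" using attained by blast
      show "N' (r *\<^sub>R x) \<le> \<bar>r\<bar> * N' x" unfolding a(2)
        using mult_left_mono[OF upper[OF a(1), of x], of "\<bar>r\<bar>"] by (simp add: abs_mult)
      obtain a where a: "a < m" "N' x = \<bar>Y a \<bullet> x\<bar> / b a" using attained by blast
      show "\<bar>r\<bar> * N' x \<le> N' (r *\<^sub>R x)" unfolding a(2)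
        using upper[OF a(1), of "r *\<^sub>R x"] by (simp add: abs_mult)
    qed
    show "N' (x + y) \<le> N' x + N' y" for x y
    proof -
      obtain a where a: "a < m" "N' (x + y) = \<bar>Y a \<bullet> (x + y)\<bar> / b a" using attained by blast
      have "\<bar>Y a \<bullet> (x + y)\<bar> / b a \<le> (\<bar>Y a \<bullet> x\<bar> + \<bar>Y a \<bullet> y\<bar>) / b a"
        using b0[of a] by (intro divide_right_mono) (auto simp: inner_add_right)
      also have "\<dots> \<le> N' x + N' y" using upper[OF a(1)] by (simp add: add_divide_distrib add_mono)
      finally show ?thesis unfolding a(2) .
    qed
  qed
qed

text \<open>
  The unit vectors of a coincidence satisfy equations \<open>Y (\<alpha> j) \<bullet> x = \<epsilon>
  j * b (\<alpha> j)\<close> with signs \<open>\<epsilon> j\<close> when they lie, up to sign, on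
  distinct edge lines \<open>\<alpha> j\<close> of a polygonal norm. The left-hand sides are
  \<open>2 * k + 1\<close> linear forms in the \<open>2 * k\<close> coordinates of the vectors
  \<open>v i\<close>, so a nontrivial combination \<open>l\<close> of them vanishes identically.
  Hence the weights \<open>b\<close> satisfy a nontrivial linear relation, where distinctness of the
  \<open>\<alpha> j\<close> prevents cancellation. Only finitely many relations arise, and generic
  weights violate them all.
\<close>

lemma weights_avoiding_coincidences:
  fixes Y :: "nat \<Rightarrow> real ^ 2"
  assumes "s > 0"
  shows "\<exists>b. (\<forall>a. 1 \<le> b a \<and> b a \<le> 1 + s) \<and>
    (\<forall>(v :: nat \<Rightarrow> real ^ 2) \<alpha> \<epsilon>. \<alpha> ` {..<2 * k + 1} \<subseteq> {..<m} \<longrightarrow> inj_on \<alpha> {..<2 * k + 1} \<longrightarrow>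
       (\<forall>j<2 * k + 1. \<epsilon> j \<in> {-1, 1}) \<longrightarrow>
       \<not> (\<forall>j<2 * k + 1. Y (\<alpha> j) \<bullet> rational_combination k q v j = \<epsilon> j * b (\<alpha> j)))"
proof -
  let ?J = "{..<2 * k + 1}"
  have "\<exists>l. (\<exists>j\<in>?J. l j \<noteq> 0) \<and> (\<forall>i<k. (\<Sum>j<2 * k + 1. (l j * of_rat (q ! j ! i)) *\<^sub>R Y (\<alpha> j)) = 0)"
    for \<alpha> :: "nat \<Rightarrow> nat"
  proof -
    have "\<exists>l. (\<exists>j\<in>?J. l j \<noteq> 0) \<and>
        (\<forall>e\<in>{..<k} \<times> (UNIV :: 2 set). (\<Sum>j\<in>?J. l j * (of_rat (q ! j ! fst e) * Y (\<alpha> j) $ snd e)) = 0)"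
      by (rule homogeneous_system_nontrivial_solution) (simp_all add: card_cartesian_product)
    then obtain l where l: "\<exists>j\<in>?J. l j \<noteq> 0"
      "\<forall>e\<in>{..<k} \<times> (UNIV :: 2 set). (\<Sum>j\<in>?J. l j * (of_rat (q ! j ! fst e) * Y (\<alpha> j) $ snd e)) = 0"
      by (elim exE conjE)
    have "(\<Sum>j<2 * k + 1. (l j * of_rat (q ! j ! i)) *\<^sub>R Y (\<alpha> j)) = 0" if "i < k" for i
    proof (subst vec_eq_iff, intro allI)
      fix d :: 2
      have "(i, d) \<in> {..<k} \<times> UNIV" using that by simp
      from bspec[OF l(2) this] show "(\<Sum>j<2 * k + 1. (l j * of_rat (q ! j ! i)) *\<^sub>R Y (\<alpha> j)) $ d = 0 $ d"
        by (simp add: sum_component mult.assoc del: sum.lessThan_Suc)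
    qed
    then show ?thesis using l(1) by blast
  qed
  then have "\<exists>l. \<forall>\<alpha> :: nat \<Rightarrow> nat. (\<exists>j\<in>?J. l \<alpha> j \<noteq> 0) \<and>
      (\<forall>i<k. (\<Sum>j<2 * k + 1. (l \<alpha> j * of_rat (q ! j ! i)) *\<^sub>R Y (\<alpha> j)) = 0)"
    by (intro choice allI)
  then obtain l where l_all: "\<forall>\<alpha> :: nat \<Rightarrow> nat. (\<exists>j\<in>?J. l \<alpha> j \<noteq> 0) \<and>
      (\<forall>i<k. (\<Sum>j<2 * k + 1. (l \<alpha> j * of_rat (q ! j ! i)) *\<^sub>R Y (\<alpha> j)) = 0)"
    by (rule exE)
  have l: "\<exists>j\<in>?J. l \<alpha> j \<noteq> 0"
    "i < k \<Longrightarrow> (\<Sum>j<2 * k + 1. (l \<alpha> j * of_rat (q ! j ! i)) *\<^sub>R Y (\<alpha> j)) = 0" for \<alpha> i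
    using spec[OF l_all, of \<alpha>] by simp_all
  (* The coefficient of b x in the relation that belongs to the edges \<alpha> and the signs \<epsilon>. *)
  define f where "f \<alpha> \<epsilon> x = (\<Sum>j\<in>?J. if \<alpha> j = x then l \<alpha> j * \<epsilon> j else 0)" for \<alpha> :: "nat \<Rightarrow> nat" and \<epsilon> :: "nat \<Rightarrow> real" and x
  define A where "A = {\<alpha> \<in> ?J \<rightarrow>\<^sub>E {..<m}. inj_on \<alpha> ?J}"
  define S where "S = ?J \<rightarrow>\<^sub>E {-1, 1 :: real}"
  define F where "F = (\<lambda>(\<alpha>, \<epsilon>). f \<alpha> \<epsilon>) ` (A \<times> S)"
  have "finite A" unfolding A_def using finite_PiE[of ?J "\<lambda>_. {..<m}"] by simp
  moreover have "finite S" unfolding S_def by (intro finite_PiE) auto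
  ultimately have finite_F: "finite F" unfolding F_def by blast
  have nonzero_F: "\<exists>a<m. g a \<noteq> 0" if g: "g \<in> F" for g
  proof -
    obtain \<alpha> \<epsilon> where \<alpha>: "\<alpha> \<in> A" "\<epsilon> \<in> S" "g = f \<alpha> \<epsilon>" using g unfolding F_def by auto
    obtain i where i: "i \<in> ?J" "l \<alpha> i \<noteq> 0" using l(1) by blast
    have "f \<alpha> \<epsilon> (\<alpha> i) = (\<Sum>j\<in>?J. if j = i then l \<alpha> j * \<epsilon> j else 0)"
      unfolding f_def using \<alpha>(1) i(1) unfolding A_def inj_on_def by (intro sum.cong) auto
    also have "\<dots> = l \<alpha> i * \<epsilon> i" using i(1) by (subst sum.delta) auto
    also have "\<dots> \<noteq> 0" using i PiE_mem[OF \<alpha>(2)[unfolded S_def] i(1)] by auto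
    finally show ?thesis using PiE_mem[of \<alpha> ?J "\<lambda>_. {..<m}" i] \<alpha>(1,3) i(1) unfolding A_def by auto
  qed
  obtain b where b: "(\<forall>a. 1 \<le> b a \<and> b a \<le> 1 + s) \<and> (\<forall>g\<in>F. (\<Sum>a<m. g a * b a) \<noteq> 0)"
    using generic_weights[OF finite_F nonzero_F assms] by (rule exE)
  show ?thesis
  proof (intro exI[of _ b] conjI[OF conjunct1[OF b]] allI impI notI)
    fix v :: "nat \<Rightarrow> real ^ 2" and \<alpha>' \<epsilon>'
    assume \<alpha>': "\<alpha>' ` ?J \<subseteq> {..<m}" "inj_on \<alpha>' ?J" and \<epsilon>': "\<forall>j<2 * k + 1. \<epsilon>' j \<in> {-1, 1}"
      and eq': "\<forall>j<2 * k + 1. Y (\<alpha>' j) \<bullet> rational_combination k q v j = \<epsilon>' j * b (\<alpha>' j)"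
    (* The index sets A and S of the finitely many relations consist of functions that are undefined outside ?J. *)
    define \<alpha> \<epsilon> where "\<alpha> = restrict \<alpha>' ?J" and "\<epsilon> = restrict \<epsilon>' ?J"
    have \<alpha>: "\<alpha> \<in> A" unfolding A_def \<alpha>_def using \<alpha>' by (auto simp: inj_on_def)
    have \<epsilon>: "\<epsilon> \<in> S" unfolding S_def \<epsilon>_def using \<epsilon>' by (intro restrict_PiE[THEN iffD2]) auto
    have eq: "Y (\<alpha> j) \<bullet> rational_combination k q v j = \<epsilon> j * b (\<alpha> j)" if "j \<in> ?J" for j
      using eq' that unfolding \<alpha>_def \<epsilon>_def by simp
    have "(\<Sum>a<m. f \<alpha> \<epsilon> a * b a) = (\<Sum>a<m. \<Sum>j\<in>?J. if \<alpha> j = a then l \<alpha> j * \<epsilon> j * b (\<alpha> j) else 0)"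
      unfolding f_def sum_distrib_right by (intro sum.cong) auto
    also have "\<dots> = (\<Sum>j\<in>?J. \<Sum>a<m. if \<alpha> j = a then l \<alpha> j * \<epsilon> j * b (\<alpha> j) else 0)" by (rule sum.swap)
    also have "\<dots> = (\<Sum>j\<in>?J. l \<alpha> j * (\<epsilon> j * b (\<alpha> j)))"
      using \<alpha> unfolding A_def by (intro sum.cong) (auto simp: sum.delta' dest: PiE_mem)
    also have "\<dots> = (\<Sum>j\<in>?J. l \<alpha> j * (Y (\<alpha> j) \<bullet> rational_combination k q v j))"
      by (intro sum.cong) (simp_all add: eq)
    also have "\<dots> = (\<Sum>j\<in>?J. \<Sum>i<k. ((l \<alpha> j * of_rat (q ! j ! i)) *\<^sub>R Y (\<alpha> j)) \<bullet> v i)"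
      unfolding rational_combination_def
      by (intro sum.cong refl) (simp add: inner_sum_right sum_distrib_left mult.assoc)
    also have "\<dots> = (\<Sum>i<k. \<Sum>j\<in>?J. ((l \<alpha> j * of_rat (q ! j ! i)) *\<^sub>R Y (\<alpha> j)) \<bullet> v i)"
      by (rule sum.swap)
    also have "\<dots> = (\<Sum>i<k. (\<Sum>j\<in>?J. (l \<alpha> j * of_rat (q ! j ! i)) *\<^sub>R Y (\<alpha> j)) \<bullet> v i)"
      by (simp only: inner_sum_left)
    also have "\<dots> = 0" using l(2) by (intro sum.neutral) (simp del: sum.lessThan_Suc)
    finally have "(\<Sum>a<m. f \<alpha> \<epsilon> a * b a) = 0" .
    moreover have "f \<alpha> \<epsilon> \<in> F" unfolding F_def using \<alpha> \<epsilon> by force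
    ultimately show False using b by blast
  qed
qed

text \<open>
  Two unit vectors \<open>x\<close>, \<open>y\<close> on one edge of the polygon have a midpoint on
  the edge line, which lies outside the interior of the unit ball of \<open>N\<close>. So \<open>N
  (x + y)\<close> is at least 2, and uniform convexity of \<open>N\<close> makes \<open>norm (x -
  y)\<close> small. Therefore separated unit vectors lie on distinct edges, and generic weights
  exclude a coincidence.
\<close>

lemma polygonal_norm_without_coincidence:
  fixes N :: "real ^ 2 \<Rightarrow> real"
  assumes N: "is_norm N" and "\<eta> > 0" "t > 0"
    and uniform: "\<And>x y. (N (x + y))\<^sup>2 + \<eta> * (norm (x - y))\<^sup>2 \<le> 2 * (N x)\<^sup>2 + 2 * (N y)\<^sup>2"
  obtains N' where "is_norm N'" "\<And>x. N' x \<le> N x" "\<And>x. N x \<le> (1 + t) * N' x" "\<And>v. \<not> coincidence k q n N' v"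
proof -
  define \<delta> where "\<delta> = 1 / real (Suc n)"
  (* The choice of \<tau> gives 4 * (1 + \<tau>)^2 < 4 + \<eta> * \<delta>^2, which is what makes the edges shorter than \<delta>.
     The two approximations, by finitely many functionals and by varying their weights, cost a factor
     1 + s each, and (1 + s)^2 \<le> 1 + \<tau> for s = \<tau> / 3. *)
  define \<tau> where "\<tau> = min (min t 1) (\<eta> * \<delta>\<^sup>2 / 24)"
  have "\<delta> > 0" unfolding \<delta>_def by simp
  then have \<tau>: "\<tau> > 0" "\<tau> \<le> t" "\<tau> \<le> 1" "24 * \<tau> \<le> \<eta> * \<delta>\<^sup>2" using assms(2,3) unfolding \<tau>_def by auto
  have "\<tau> * \<tau> \<le> \<tau> * 1" using \<tau> by (intro mult_left_mono) auto
  moreover have "4 * (1 + \<tau>)\<^sup>2 = 4 + 8 * \<tau> + 4 * (\<tau> * \<tau>)" by (simp add: power2_eq_square algebra_simps)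
  ultimately have small: "4 * (1 + \<tau>)\<^sup>2 < 4 + \<eta> * \<delta>\<^sup>2" using \<tau>(1,4) by linarith
  define s where "s = \<tau> / 3"
  have "s > 0" using \<tau> unfolding s_def by simp
  have "s * s \<le> s * 1" using \<tau> unfolding s_def by (intro mult_left_mono) auto
  then have s2: "(1 + s)\<^sup>2 \<le> 1 + \<tau>" unfolding s_def by (simp add: power2_eq_square algebra_simps)
  obtain m Y where mY_all: "0 < m \<and> (\<forall>a x. \<bar>Y a \<bullet> x\<bar> \<le> N x) \<and>
      (\<forall>x. \<exists>a<m. N x \<le> (1 + s) * \<bar>Y (a::nat) \<bullet> x\<bar>)"
    using finitely_many_supporting_functionals[OF N \<open>s > 0\<close>] by (elim exE)
  then have mY: "m > 0" "\<And>a x. \<bar>Y a \<bullet> x\<bar> \<le> N x" "\<And>x. \<exists>a<m. N x \<le> (1 + s) * \<bar>Y a \<bullet> x\<bar>"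
    by simp_all
  obtain b where b_all: "(\<forall>a. 1 \<le> b a \<and> b a \<le> 1 + s) \<and>
    (\<forall>(v :: nat \<Rightarrow> real ^ 2) \<alpha> \<epsilon>. \<alpha> ` {..<2 * k + 1} \<subseteq> {..<m} \<longrightarrow> inj_on \<alpha> {..<2 * k + 1} \<longrightarrow>
       (\<forall>j<2 * k + 1. \<epsilon> j \<in> {-1, 1}) \<longrightarrow>
       \<not> (\<forall>j<2 * k + 1. Y (\<alpha> j) \<bullet> rational_combination k q v j = \<epsilon> j * b (\<alpha> j)))"
    using weights_avoiding_coincidences[OF \<open>s > 0\<close>, of k m Y q] by (rule exE)
  then have b: "1 \<le> b a" "b a \<le> 1 + s" for a by simp_all
  define N' where "N' = polygonal_norm m Y b"
  note poly = is_norm_polygonal[where Y = Y and b = b, OF N mY(1) \<open>s > 0\<close> mY(2,3) b(1,2), folded N'_def]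
  have le: "N x \<le> (1 + \<tau>) * N' x" for x
    using poly(4)[of x] mult_right_mono[OF s2 is_norm_nonneg[OF poly(1), of x]] by linarith
  have facet: "norm (x - y) < \<delta>" if "N' x = 1" "N' y = 1" "Y a \<bullet> x = Y a \<bullet> y" "\<bar>Y a \<bullet> y\<bar> = b a" for a x y
  proof -
    have "2 * b a = \<bar>Y a \<bullet> (x + y)\<bar>" using that by (simp add: inner_add_right)
    then have "2 \<le> N (x + y)" using mY(2)[of a "x + y"] b(1)[of a] by linarith
    then have "2\<^sup>2 \<le> (N (x + y))\<^sup>2" by (intro power_mono) auto
    moreover have "(N x)\<^sup>2 \<le> (1 + \<tau>)\<^sup>2" "(N y)\<^sup>2 \<le> (1 + \<tau>)\<^sup>2"
      using le[of x] le[of y] that(1,2) by (auto intro!: power_mono is_norm_nonneg[OF N])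
    ultimately have "\<eta> * (norm (x - y))\<^sup>2 < \<eta> * \<delta>\<^sup>2" using uniform[of x y] small by simp
    then have "(norm (x - y))\<^sup>2 < \<delta>\<^sup>2" using assms(2) by simp
    then show ?thesis using \<open>\<delta> > 0\<close> by (simp add: power2_less_imp_less)
  qed
  have "\<not> coincidence k q n N' v" for v
  proof
    assume c: "coincidence k q n N' v"
    let ?u = "rational_combination k q v"
    have unit: "N' (?u j) = 1" if "j < 2 * k + 1" for j using c that unfolding coincidence_def by blast
    have sep: "\<delta> \<le> norm (?u j - ?u j')" "\<delta> \<le> norm (?u j + ?u j')" if "j < 2 * k + 1" "j' < j" for j j'
      using c that unfolding coincidence_def \<delta>_def by blast+
    have "\<exists>a<m. j < 2 * k + 1 \<longrightarrow> \<bar>Y a \<bullet> ?u j\<bar> = b a" for j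
      using poly(2)[of "?u j"] unit[of j] by force
    then obtain \<alpha> where \<alpha>: "\<And>j. \<alpha> j < m" "\<And>j. j < 2 * k + 1 \<Longrightarrow> \<bar>Y (\<alpha> j) \<bullet> ?u j\<bar> = b (\<alpha> j)" by metis
    have ne: "\<alpha> j \<noteq> \<alpha> j'" if j: "j < 2 * k + 1" "j' < j" for j j'
    proof
      assume eq: "\<alpha> j = \<alpha> j'"
      have j': "j' < 2 * k + 1" using j by simp
      have abs: "\<bar>Y (\<alpha> j') \<bullet> ?u j\<bar> = b (\<alpha> j')" "\<bar>Y (\<alpha> j') \<bullet> ?u j'\<bar> = b (\<alpha> j')"
        using \<alpha>(2)[OF j(1)] \<alpha>(2)[OF j'] eq by simp_all
      then consider "Y (\<alpha> j') \<bullet> ?u j = Y (\<alpha> j') \<bullet> ?u j'" | "Y (\<alpha> j') \<bullet> ?u j = Y (\<alpha> j') \<bullet> (- ?u j')"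
        by (auto simp: abs_if split: if_splits)
      then show False
      proof cases
        case 1
        then show False using facet[OF unit[OF j(1)] unit[OF j'] 1 abs(2)] sep(1)[OF j] by linarith
      next
        case 2
        have "N' (- ?u j') = 1" using unit[OF j'] by (simp add: is_norm_uminus[OF poly(1)])
        moreover have "\<bar>Y (\<alpha> j') \<bullet> (- ?u j')\<bar> = b (\<alpha> j')" using abs(2) by simp
        ultimately have "norm (?u j - - ?u j') < \<delta>" using facet[OF unit[OF j(1)] _ 2] by blast
        then show False using sep(2)[OF j] by simp
      qed
    qed
    have "\<alpha> ` {..<2 * k + 1} \<subseteq> {..<m}" using \<alpha>(1) by auto
    moreover have "inj_on \<alpha> {..<2 * k + 1}"
    proof (rule linorder_inj_onI)
      show "\<alpha> i \<noteq> \<alpha> j" if "i < j" "i \<in> {..<2 * k + 1}" "j \<in> {..<2 * k + 1}" for i j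
        using ne[of j i] that by simp
    qed auto
    moreover have "sgn (Y (\<alpha> j) \<bullet> ?u j) \<in> {-1, 1}" if "j < 2 * k + 1" for j
    proof -
      have "Y (\<alpha> j) \<bullet> ?u j \<noteq> 0" using \<alpha>(2)[OF that] b(1)[of "\<alpha> j"] by auto
      then show ?thesis by (simp add: sgn_if)
    qed
    moreover have "Y (\<alpha> j) \<bullet> ?u j = sgn (Y (\<alpha> j) \<bullet> ?u j) * b (\<alpha> j)" if "j < 2 * k + 1" for j
      unfolding \<alpha>(2)[OF that, symmetric] by (simp add: sgn_mult_abs)
    ultimately show False
      using conjunct2[OF b_all, rule_format, of \<alpha> "\<lambda>j. sgn (Y (\<alpha> j) \<bullet> ?u j)" v] by blast
  qed
  moreover have "N x \<le> (1 + t) * N' x" for x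
    using le[of x] mult_right_mono[of "1 + \<tau>" "1 + t" "N' x"] \<tau>(2) is_norm_nonneg[OF poly(1), of x] by simp
  ultimately show ?thesis using that[of N'] poly(1,3) by blast
qed

section \<open>Norms without a given coincidence are dense\<close>

text \<open>
  Adding a small multiple of the squared Euclidean norm to the square of \<open>N\<close>: the
  parallelogram law turns this summand into the gain \<open>\<eta>\<close>.
\<close>

lemma uniformly_convex_approximation:
  fixes N :: "'a::euclidean_space \<Rightarrow> real"
  assumes N: "is_norm N" and "t > 0"
  obtains N' \<eta> where "is_norm N'" "\<eta> > 0" "\<And>x. N x \<le> N' x" "\<And>x. N' x \<le> (1 + t) * N x"
    "\<And>x y. (N' (x + y))\<^sup>2 + \<eta> * (norm (x - y))\<^sup>2 \<le> 2 * (N' x)\<^sup>2 + 2 * (N' y)\<^sup>2"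
proof -
  obtain c where c: "c > 0" "\<And>x. c * norm x \<le> N x" using is_norm_ge_norm[OF N] by metis
  define r where "r = t * c"
  have "r > 0" using assms(2) c(1) unfolding r_def by simp
  define N' where "N' x = sqrt ((N x)\<^sup>2 + (r * norm x)\<^sup>2)" for x
  have sq: "(N' x)\<^sup>2 = (N x)\<^sup>2 + (r * norm x)\<^sup>2" for x unfolding N'_def by simp
  have ge: "N x \<le> N' x" for x unfolding N'_def by (simp add: real_le_rsqrt)
  have le: "N' x \<le> (1 + t) * N x" for x
  proof -
    have "N' x \<le> \<bar>N x\<bar> + \<bar>r * norm x\<bar>" unfolding N'_def by (rule sqrt_sum_squares_le_sum_abs)
    also have "\<dots> = N x + t * (c * norm x)"
      using is_norm_nonneg[OF N, of x] \<open>r > 0\<close> unfolding r_def by simp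
    also have "\<dots> \<le> N x + t * N x" using c(2)[of x] assms(2) by simp
    finally show ?thesis by (simp add: algebra_simps)
  qed
  have "is_norm N'" unfolding is_norm_def
  proof (intro conjI allI)
    show "0 \<le> N' x" for x unfolding N'_def by simp
    show "N' x = 0 \<longleftrightarrow> x = 0" for x
      unfolding N'_def using \<open>r > 0\<close> by (auto simp: is_norm_0[OF N] sum_power2_eq_zero_iff)
    show "N' (a *\<^sub>R x) = \<bar>a\<bar> * N' x" for a x
    proof -
      have "(N (a *\<^sub>R x))\<^sup>2 + (r * norm (a *\<^sub>R x))\<^sup>2 = a\<^sup>2 * ((N x)\<^sup>2 + (r * norm x)\<^sup>2)"
        by (simp add: is_norm_scale[OF N] power_mult_distrib algebra_simps)
      then show ?thesis unfolding N'_def by (simp add: real_sqrt_mult)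
    qed
    show "N' (x + y) \<le> N' x + N' y" for x y
    proof -
      have "r * norm (x + y) \<le> r * norm x + r * norm y"
        using norm_triangle_ineq[of x y] \<open>r > 0\<close> by (simp flip: distrib_left)
      then have "N' (x + y) \<le> sqrt ((N x + N y)\<^sup>2 + (r * norm x + r * norm y)\<^sup>2)" unfolding N'_def
        using is_norm_triangle[OF N, of x y] is_norm_nonneg[OF N, of "x + y"] \<open>r > 0\<close>
        by (intro real_sqrt_le_mono add_mono power_mono) simp_all
      also have "\<dots> \<le> N' x + N' y" unfolding N'_def by (rule real_sqrt_sum_squares_triangle_ineq)
      finally show ?thesis .
    qed
  qed
  moreover have "(N' (x + y))\<^sup>2 + r\<^sup>2 * (norm (x - y))\<^sup>2 \<le> 2 * (N' x)\<^sup>2 + 2 * (N' y)\<^sup>2" for x y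
  proof -
    have "(norm (x + y))\<^sup>2 + (norm (x - y))\<^sup>2 = 2 * (norm x)\<^sup>2 + 2 * (norm y)\<^sup>2"
      by (simp add: power2_norm_eq_inner inner_add inner_diff inner_commute)
    then have "r\<^sup>2 * (norm (x + y))\<^sup>2 + r\<^sup>2 * (norm (x - y))\<^sup>2 = 2 * (r\<^sup>2 * (norm x)\<^sup>2) + 2 * (r\<^sup>2 * (norm y)\<^sup>2)"
      by (metis distrib_left mult.left_commute)
    moreover have "(N (x + y))\<^sup>2 \<le> (N x + N y)\<^sup>2"
      using is_norm_triangle[OF N, of x y] is_norm_nonneg[OF N, of "x + y"] by (intro power_mono)
    moreover have "(N x + N y)\<^sup>2 + (N x - N y)\<^sup>2 = 2 * (N x)\<^sup>2 + 2 * (N y)\<^sup>2"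
      by (simp add: power2_eq_square algebra_simps)
    moreover have "0 \<le> (N x - N y)\<^sup>2" by simp
    ultimately show ?thesis unfolding sq power_mult_distrib by argo
  qed
  ultimately show ?thesis using that[of N' "r\<^sup>2"] ge le \<open>r > 0\<close> by simp
qed

lemma norms_without_coincidence_dense:
  fixes N :: "real ^ 2 \<Rightarrow> real"
  assumes N: "is_norm N" and "e > 0"
  obtains N' where "is_norm N'" "\<And>v. \<not> coincidence k q n N' v"
    "hausdorff_dist (unit_ball N) (unit_ball N') < e"
proof -
  obtain c where c: "c > 0" "\<And>x. c * norm x \<le> N x" using is_norm_ge_norm[OF N] by metis
  define t where "t = e * c / 2"
  have t: "t > 0" "t * (1 / c) < e" using c(1) \<open>e > 0\<close> unfolding t_def by simp_all
  obtain N1 \<eta> where N1: "is_norm N1" "\<eta> > 0" "\<And>x. N x \<le> N1 x" "\<And>x. N1 x \<le> (1 + t) * N x"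
    "\<And>x y. (N1 (x + y))\<^sup>2 + \<eta> * (norm (x - y))\<^sup>2 \<le> 2 * (N1 x)\<^sup>2 + 2 * (N1 y)\<^sup>2"
    by (rule uniformly_convex_approximation[OF N t(1)]) blast
  obtain N2 where N2: "is_norm N2" "\<And>x. N2 x \<le> N1 x" "\<And>x. N1 x \<le> (1 + t) * N2 x"
    "\<And>v. \<not> coincidence k q n N2 v"
    by (rule polygonal_norm_without_coincidence[OF N1(1,2) t(1) N1(5)]) blast
  have "hausdorff_dist (unit_ball N) (unit_ball N2) \<le> t * (1 / c)"
  proof (rule hausdorff_dist_unit_balls_le[OF N N2(1)])
    show "norm x \<le> 1 / c * N x" for x using c(2)[of x] c(1) by (simp add: field_simps)
    show "N x \<le> (1 + t) * N2 x" for x using N1(3)[of x] N2(3)[of x] by linarith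
    show "N2 x \<le> (1 + t) * N x" for x using N1(4)[of x] N2(2)[of x] by linarith
  qed (use t in simp)
  then show ?thesis using that N2(1,4) t(2) by simp
qed

text \<open>
  An open set of bodies that meets \<open>degenerate_bodies k q n\<close> contains the unit ball of
  some norm, near which density provides a norm without a coincidence, and stability a whole
  neighbourhood of such norms.
\<close>

lemma degenerate_bodies_nowhere_dense:
  "nowhere_dense_in Hausdorff.mtopology (degenerate_bodies k q n)"
  unfolding nowhere_dense_in_def
proof (intro conjI allI impI)
  show "degenerate_bodies k q n \<subseteq> topspace Hausdorff.mtopology"
    unfolding degenerate_bodies_def using unit_ball_in_bodies2 by auto
  fix U assume U: "openin Hausdorff.mtopology U \<and> U \<noteq> {}"
  show "\<exists>V. openin Hausdorff.mtopology V \<and> V \<noteq> {} \<and> V \<subseteq> U \<and> V \<inter> degenerate_bodies k q n = {}"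
  proof (cases "U \<inter> degenerate_bodies k q n = {}")
    case True
    then show ?thesis using U by blast
  next
    case False
    then obtain N where N: "is_norm N" "unit_ball N \<in> U" unfolding degenerate_bodies_def by blast
    then obtain e where e: "e > 0" "Hausdorff.mball (unit_ball N) e \<subseteq> U"
      using U unfolding Hausdorff.openin_mtopology by blast
    obtain N' where N': "is_norm N'" "\<And>v. \<not> coincidence k q n N' v"
      "hausdorff_dist (unit_ball N) (unit_ball N') < e"
      by (rule norms_without_coincidence_dense[OF N(1) e(1)]) blast
    obtain e' where e': "e' > 0" "\<And>N''. is_norm N'' \<Longrightarrow>
        hausdorff_dist (unit_ball N'') (unit_ball N') < e' \<Longrightarrow> \<nexists>v. coincidence k q n N'' v"
      using no_coincidence_stable[OF N'(1), of k q n] N'(2) by blast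
    let ?V = "U \<inter> Hausdorff.mball (unit_ball N') e'"
    have "openin Hausdorff.mtopology ?V" using U by blast
    moreover have "unit_ball N' \<in> ?V"
      using e e'(1) N' N(1) unit_ball_in_bodies2 Hausdorff.mdist_zero by auto
    moreover have "?V \<inter> degenerate_bodies k q n = {}"
    proof (intro equals0I)
      fix K assume K: "K \<in> ?V \<inter> degenerate_bodies k q n"
      then obtain N'' v where N'': "K = unit_ball N''" "is_norm N''" "coincidence k q n N'' v"
        unfolding degenerate_bodies_def by blast
      moreover have "hausdorff_dist (unit_ball N'') (unit_ball N') < e'"
        using K unfolding N''(1) by (simp add: hausdorff_dist_commute)
      ultimately show False using e'(2) by blast
    qed
    ultimately show ?thesis by blast
  qed
qed

section \<open>The chromatic number of a typical norm\<close>

lemma meagre_in_subset_countable_Union: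
  assumes "countable \<F>" "\<And>T. T \<in> \<F> \<Longrightarrow> nowhere_dense_in X T" "S \<subseteq> \<Union>\<F>"
  shows "meagre_in X S"
  unfolding meagre_in_def
proof (intro exI conjI ballI)
  show "countable ((\<lambda>T. T \<inter> S) ` \<F>)" using assms(1) by simp
  show "S = \<Union>((\<lambda>T. T \<inter> S) ` \<F>)" using assms(3) by blast
  fix T assume "T \<in> (\<lambda>T. T \<inter> S) ` \<F>"
  then obtain T' where T': "T' \<in> \<F>" "T \<subseteq> T'" by blast
  show "nowhere_dense_in X T" unfolding nowhere_dense_in_def
  proof (intro conjI allI impI)
    have nd: "T' \<subseteq> topspace X"
      "\<forall>U. openin X U \<and> U \<noteq> {} \<longrightarrow> (\<exists>V. openin X V \<and> V \<noteq> {} \<and> V \<subseteq> U \<and> V \<inter> T' = {})"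
      using assms(2)[OF T'(1)] unfolding nowhere_dense_in_def by simp_all
    show "T \<subseteq> topspace X" using T'(2) nd(1) by simp
    fix U assume "openin X U \<and> U \<noteq> {}"
    then obtain V where "openin X V" "V \<noteq> {}" "V \<subseteq> U" "V \<inter> T' = {}"
      using spec[OF nd(2), of U] by meson
    then show "\<exists>V. openin X V \<and> V \<noteq> {} \<and> V \<subseteq> U \<and> V \<inter> T = {}"
      using T'(2) by (intro exI[of _ V]) auto
  qed
qed

theorem theorem1p4:
  shows "for_all_norms_besides_meagre
           (\<lambda>N. chromatic_number (UNIV :: (real ^ 2) set) (unit_distance_adj N) = 4)"
  unfolding for_all_norms_besides_meagre_def
proof (rule meagre_in_subset_countable_Union)
  let ?\<F> = "range (\<lambda>(k, q, n). degenerate_bodies k q n)"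
  show "countable ?\<F>" by simp
  show "nowhere_dense_in Hausdorff.mtopology T" if "T \<in> ?\<F>" for T
    using that degenerate_bodies_nowhere_dense by auto
  show "{unit_ball N |N. is_norm N \<and> chromatic_number (UNIV :: (real ^ 2) set) (unit_distance_adj N) \<noteq> 4} \<subseteq> \<Union>?\<F>"
  proof clarify
    fix N :: "real ^ 2 \<Rightarrow> real"
    assume N: "is_norm N" "chromatic_number UNIV (unit_distance_adj N) \<noteq> 4"
    have "\<exists>k q n v. coincidence k q n N v"
    proof (rule ccontr)
      assume "\<nexists>k q n v. coincidence k q n N v"
      then have "\<exists>c. proper_colouring UNIV (unit_distance_adj N) (Suc 3) c"
        using four_colouring_if_no_coincidence[OF N(1)] by simp
      from chromatic_number_eqI[OF this no_three_colouring[OF N(1)]] show False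
        using N(2) by (simp add: numeral_eq_enat)
    qed
    then obtain k q n v where "coincidence k q n N v" by blast
    then have "unit_ball N \<in> degenerate_bodies k q n" using N(1) unfolding degenerate_bodies_def by blast
    then show "unit_ball N \<in> \<Union>?\<F>" by (intro UnionI[of "degenerate_bodies k q n"]) force+
  qed
qed

end
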